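(* Let $A$ be a unital C*-algebra and let $\mathcal M$ be a finitely generated projective $A$-module. For every finite set $\{x_1,\dots,x_k\}$ of non-zero algebraic generators of the $A$-module $\mathcal M$ there exists a unique $A$-valued inner product $\langle\cdot,\cdot\rangle_0$ on $\mathcal M$ that turns $\mathcal M$ into a Hilbert $A$-module in which $\{x_1,\dots,x_k\}$ is a normalized tight frame; and $\mathcal M$ can be reconstructed up to $A$-module isomorphism from the set of generators $\{x_1,\dots,x_k\}$ together with the $k\times k$ matrix $(a_{ij})$ over $A$, $a_{ij}=\langle x_i,x_j\rangle_0$ for $1\le i\le j\le k$ and $a_{ji}=a_{ij}^*$. That is: if $\mathcal N$ is another finitely generated projective $A$-module with a finite set of non-zero algebraic generators $\{y_1,\dots,y_k\}$ of the same length $k$, and if the correspondingly determined inner product $\langle\cdot,\cdot\rangle_0'$ on $\mathcal N$ satisfies $\langle y_i,y_j\rangle_0'=\langle x_i,x_j\rangle_0$ for all $1\le i\le j\le k$, then $\mathcal M$ and $\mathcal N$ are isomorphic as $A$-modules. Moreover, the number of elements in sets of algebraic generators of $\mathcal M$ has a minimum, and for this reconstruction it suffices to consider sets of generators of minimal length.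
   Context: Modules are left $A$-modules. An $A$-valued inner product $\langle\cdot,\cdot\rangle:\mathcal M\times\mathcal M\to A$ satisfies $\langle x,x\rangle\ge 0$, $\langle x,x\rangle=0$ iff $x=0$, $\langle x,y\rangle=\langle y,x\rangle^*$, $\langle ax,y\rangle=a\langle x,y\rangle$ for $a\in A$, and additivity in the first argument. A Hilbert $A$-module is a module with such an inner product that is complete for the norm $\|x\|=\|\langle x,x\rangle\|^{1/2}$. A finite set $\{x_1,\dots,x_k\}$ is a set of algebraic generators of $\mathcal M$ if every $x\in\mathcal M$ has the form $\sum_i a_ix_i$ with $a_i\in A$. It is a normalized tight frame of a Hilbert $A$-module $\{\mathcal M,\langle\cdot,\cdot\rangle\}$ if $\langle x,x\rangle=\sum_{j=1}^k\langle x,x_j\rangle\langle x_j,x\rangle$ for every $x\in\mathcal M$. *)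

theory Defs
  imports "HOL-Analysis.Analysis" "HOL-Library.Function_Algebras"
begin

section \<open>Unital C*-algebras\<close>

text \<open>
  The class extends \<^class>\<open>monoid_mult\<close> rather than \<^class>\<open>real_normed_algebra_1\<close>, so that the zero
  algebra is not excluded; \<open>norm 1 = 1\<close> in every other case follows from the C*-identity.
\<close>

class unital_cstar_algebra = real_normed_algebra + banach + monoid_mult +
  fixes cscale :: "complex \<Rightarrow> 'a \<Rightarrow> 'a"  (infixr \<open>*\<^sub>C\<close> 75)
    and star :: "'a \<Rightarrow> 'a"
  assumes cscale_add_right: "c *\<^sub>C (a + b) = c *\<^sub>C a + c *\<^sub>C b"
    and cscale_add_left: "(c + d) *\<^sub>C a = c *\<^sub>C a + d *\<^sub>C a"
    and cscale_cscale: "c *\<^sub>C (d *\<^sub>C a) = (c * d) *\<^sub>C a"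
    and cscale_of_real: "complex_of_real r *\<^sub>C a = r *\<^sub>R a"
    and cscale_mult_left: "(c *\<^sub>C a) * b = c *\<^sub>C (a * b)"
    and cscale_mult_right: "a * (c *\<^sub>C b) = c *\<^sub>C (a * b)"
    and norm_cscale: "norm (c *\<^sub>C a) = cmod c * norm a"
    and star_add: "star (a + b) = star a + star b"
    and star_cscale: "star (c *\<^sub>C a) = cnj c *\<^sub>C star a"
    and star_mult: "star (a * b) = star b * star a"
    and star_star: "star (star a) = a"
    and cstar_identity: "norm (star a * a) = (norm a)\<^sup>2"

definition cstar_spectrum :: "'a::unital_cstar_algebra \<Rightarrow> complex set" where
  "cstar_spectrum a =
     {c. \<not> (\<exists>b. (a - c *\<^sub>C 1) * b = 1 \<and> b * (a - c *\<^sub>C 1) = 1)}"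

definition cstar_positive :: "'a::unital_cstar_algebra \<Rightarrow> bool" where
  "cstar_positive a \<longleftrightarrow> star a = a \<and> cstar_spectrum a \<subseteq> complex_of_real ` {0..}"


section \<open>Left modules\<close>

text \<open>
  The library's module locales require commutative scalars.
\<close>

locale left_module =
  fixes scale :: "'a::{ring,monoid_mult} \<Rightarrow> 'm::ab_group_add \<Rightarrow> 'm"
  assumes scale_add_right: "scale a (x + y) = scale a x + scale a y"
    and scale_add_left: "scale (a + b) x = scale a x + scale b x"
    and scale_scale: "scale a (scale b x) = scale (a * b) x"
    and scale_one: "scale 1 x = x"

definition left_linear ::
    "('a \<Rightarrow> 'm::ab_group_add \<Rightarrow> 'm) \<Rightarrow> ('a \<Rightarrow> 'n::ab_group_add \<Rightarrow> 'n) \<Rightarrow> ('m \<Rightarrow> 'n) \<Rightarrow> bool" where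
  "left_linear sM sN f \<longleftrightarrow>
     (\<forall>x y. f (x + y) = f x + f y) \<and> (\<forall>a x. f (sM a x) = sN a (f x))"

definition left_module_isomorphic ::
    "('a \<Rightarrow> 'm::ab_group_add \<Rightarrow> 'm) \<Rightarrow> ('a \<Rightarrow> 'n::ab_group_add \<Rightarrow> 'n) \<Rightarrow> bool" where
  "left_module_isomorphic sM sN \<longleftrightarrow> (\<exists>f. left_linear sM sN f \<and> bij f)"

definition left_submodule :: "('a \<Rightarrow> 'm::ab_group_add \<Rightarrow> 'm) \<Rightarrow> 'm set \<Rightarrow> bool" where
  "left_submodule s P \<longleftrightarrow>
     0 \<in> P \<and> (\<forall>x\<in>P. \<forall>y\<in>P. x + y \<in> P) \<and> (\<forall>a. \<forall>x\<in>P. s a x \<in> P)"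

text \<open>
  The free module of rank \<open>n\<close> is realised inside \<open>nat \<Rightarrow> 'a\<close> as the functions vanishing
  outside \<open>{..<n}\<close>; addition on \<open>nat \<Rightarrow> 'a\<close> is pointwise.
\<close>

definition coord_scale :: "'a::times \<Rightarrow> (nat \<Rightarrow> 'a) \<Rightarrow> nat \<Rightarrow> 'a" where
  "coord_scale a v = (\<lambda>i. a * v i)"

definition free_module :: "nat \<Rightarrow> (nat \<Rightarrow> 'a::zero) set" where
  "free_module n = {v. \<forall>i\<ge>n. v i = 0}"

text \<open>
  Finitely generated projective: isomorphic to a direct summand \<open>P\<close> of a free module of finite rank.
\<close>

definition fg_projective ::
    "('a::{ring,monoid_mult} \<Rightarrow> 'm::ab_group_add \<Rightarrow> 'm) \<Rightarrow> bool" where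
  "fg_projective s \<longleftrightarrow> left_module s \<and>
     (\<exists>n P Q f.
        left_submodule coord_scale P \<and> P \<subseteq> free_module n \<and>
        left_submodule coord_scale Q \<and> Q \<subseteq> free_module n \<and>
        P \<inter> Q = {0} \<and> (\<forall>v\<in>free_module n. \<exists>p\<in>P. \<exists>q\<in>Q. v = p + q) \<and>
        left_linear s coord_scale f \<and> bij_betw f UNIV P)"

text \<open>
  Finite sets \<open>{x\<^sub>1, \<dots>, x\<^sub>k}\<close> are given by families \<open>x\<close> indexed by \<open>{1..k}\<close>; values of \<open>x\<close> outside
  \<open>{1..k}\<close> are irrelevant, and repetitions are not excluded.
\<close>

definition algebraic_generators ::
    "('a \<Rightarrow> 'm::ab_group_add \<Rightarrow> 'm) \<Rightarrow> nat \<Rightarrow> (nat \<Rightarrow> 'm) \<Rightarrow> bool" where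
  "algebraic_generators s k x \<longleftrightarrow> (\<forall>z. \<exists>a. z = (\<Sum>i\<in>{1..k}. s (a i) (x i)))"

definition nonzero_generators ::
    "('a \<Rightarrow> 'm::ab_group_add \<Rightarrow> 'm) \<Rightarrow> nat \<Rightarrow> (nat \<Rightarrow> 'm) \<Rightarrow> bool" where
  "nonzero_generators s k x \<longleftrightarrow> algebraic_generators s k x \<and> (\<forall>i\<in>{1..k}. x i \<noteq> 0)"


section \<open>Hilbert C*-modules\<close>

definition cstar_inner_product ::
    "('a::unital_cstar_algebra \<Rightarrow> 'm::ab_group_add \<Rightarrow> 'm) \<Rightarrow> ('m \<Rightarrow> 'm \<Rightarrow> 'a) \<Rightarrow> bool" where
  "cstar_inner_product s ip \<longleftrightarrow>
     (\<forall>x. cstar_positive (ip x x)) \<and>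
     (\<forall>x. ip x x = 0 \<longleftrightarrow> x = 0) \<and>
     (\<forall>x y. ip x y = star (ip y x)) \<and>
     (\<forall>a x y. ip (s a x) y = a * ip x y) \<and>
     (\<forall>x y z. ip (x + y) z = ip x z + ip y z)"

definition ip_norm :: "('m \<Rightarrow> 'm \<Rightarrow> 'a::unital_cstar_algebra) \<Rightarrow> 'm \<Rightarrow> real" where
  "ip_norm ip x = sqrt (norm (ip x x))"

definition ip_complete :: "('m::ab_group_add \<Rightarrow> 'm \<Rightarrow> 'a::unital_cstar_algebra) \<Rightarrow> bool" where
  "ip_complete ip \<longleftrightarrow>
     (\<forall>X :: nat \<Rightarrow> 'm.
        (\<forall>e>0. \<exists>N. \<forall>m\<ge>N. \<forall>n\<ge>N. ip_norm ip (X m - X n) < e) \<longrightarrow>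
        (\<exists>L. (\<lambda>n. ip_norm ip (X n - L)) \<longlonglongrightarrow> 0))"

definition hilbert_module ::
    "('a::unital_cstar_algebra \<Rightarrow> 'm::ab_group_add \<Rightarrow> 'm) \<Rightarrow> ('m \<Rightarrow> 'm \<Rightarrow> 'a) \<Rightarrow> bool" where
  "hilbert_module s ip \<longleftrightarrow> left_module s \<and> cstar_inner_product s ip \<and> ip_complete ip"

definition normalized_tight_frame ::
    "('m \<Rightarrow> 'm \<Rightarrow> 'a::unital_cstar_algebra) \<Rightarrow> nat \<Rightarrow> (nat \<Rightarrow> 'm) \<Rightarrow> bool" where
  "normalized_tight_frame ip k x \<longleftrightarrow>
     (\<forall>z. ip z z = (\<Sum>j\<in>{1..k}. ip z (x j) * ip (x j) z))"

definition frame_inner_product ::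
    "('a::unital_cstar_algebra \<Rightarrow> 'm::ab_group_add \<Rightarrow> 'm) \<Rightarrow> nat \<Rightarrow> (nat \<Rightarrow> 'm) \<Rightarrow>
     ('m \<Rightarrow> 'm \<Rightarrow> 'a) \<Rightarrow> bool" where
  "frame_inner_product s k x ip \<longleftrightarrow> hilbert_module s ip \<and> normalized_tight_frame ip k x"

end

theory Submission
  imports Defs
begin

text \<open>
  The coordinate map \<open>z \<mapsto> (\<langle>z, x\<^sub>j\<rangle>\<^sub>0)\<^sub>j\<close> of a normalized tight frame is an isometric section of
  \<open>F : A\<^sup>k \<rightarrow> M\<close>, \<open>a \<mapsto> \<Sum> a\<^sub>i x\<^sub>i\<close>, with range orthogonal to \<open>ker F\<close>. So the Gram matrix is the orthogonal
  projection with kernel \<open>ker F\<close>, which gives uniqueness, and it determines \<open>M\<close> as its range.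
  For existence, a projective \<open>M\<close> provides some section of \<open>F\<close>, and Kaplansky's trick for idempotents
  replaces it by the orthogonal one. This requires \<open>1 + T T*\<close> to be invertible for matrices \<open>T\<close> over
  \<open>A\<close>; rank one updates reduce that to the positivity of \<open>\<Sum> a\<^sub>i a\<^sub>i*\<close> in \<open>A\<close> itself.
\<close>

section \<open>Involution, inverses and positivity in C*-algebras\<close>

lemma star_zero [simp]: "star (0::'a::unital_cstar_algebra) = 0"
  using star_add[of "0::'a" 0] by simp

lemma star_minus: "star (- a) = - star (a::'a::unital_cstar_algebra)"
  using star_add[of a "- a"] by (simp add: eq_neg_iff_add_eq_0 add.commute)

lemma star_diff: "star (a - b) = star a - star (b::'a::unital_cstar_algebra)"
  using star_add[of a "- b"] by (simp add: star_minus)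

lemma star_sum: "star (sum f I) = (\<Sum>i\<in>I. star (f i :: 'a::unital_cstar_algebra))"
  by (induction I rule: infinite_finite_induct) (simp_all add: star_add)

lemma star_scaleR: "star (r *\<^sub>R a) = r *\<^sub>R star (a::'a::unital_cstar_algebra)"
  by (metis star_cscale cscale_of_real complex_cnj_complex_of_real)

lemma star_one [simp]: "star (1::'a::unital_cstar_algebra) = 1"
  by (metis star_mult star_star mult_1_left mult_1_right)

lemma star_power: "star (a ^ n) = star (a::'a::unital_cstar_algebra) ^ n"
  by (induction n) (simp_all add: star_mult power_commutes)

lemma norm_star [simp]: "norm (star a) = norm (a::'a::unital_cstar_algebra)"
proof -
  have "norm b \<le> norm (star b)" for b :: 'a
  proof (cases "b = 0")
    case False
    have "norm b * norm b \<le> norm (star b) * norm b"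
      using norm_mult_ineq[of "star b" b] by (simp add: cstar_identity power2_eq_square)
    then show ?thesis using False by simp
  qed simp
  from this[of a] this[of "star a"] show ?thesis by (simp add: star_star)
qed

lemma cstar_identity': "norm (a * star a) = (norm (a::'a::unital_cstar_algebra))\<^sup>2"
  using cstar_identity[of "star a"] by (simp add: star_star)

lemma mult_star_self_eq_0_iff: "star a * a = 0 \<longleftrightarrow> a = (0::'a::unital_cstar_algebra)"
  by (metis cstar_identity norm_eq_zero power_eq_0_iff mult_zero_right zero_neq_numeral)

lemma norm_one_le: "norm (1::'a::unital_cstar_algebra) \<le> 1"
proof -
  have "norm (1::'a) * norm (1::'a) = norm (1::'a)"
    using cstar_identity[of "1::'a"] by (simp add: power2_eq_square)
  then show ?thesis by (cases "norm (1::'a) = 0") auto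
qed

lemma norm_power_le: "norm (a ^ n) \<le> norm (a::'a::unital_cstar_algebra) ^ n"
proof (induction n)
  case 0
  show ?case using norm_one_le by simp
next
  case (Suc n)
  have "norm (a ^ Suc n) \<le> norm a * norm (a ^ n)" by (simp add: norm_mult_ineq)
  also have "\<dots> \<le> norm a * norm a ^ n" using Suc by (simp add: mult_left_mono)
  finally show ?case by simp
qed

lemma bounded_linear_star: "bounded_linear (star :: 'a::unital_cstar_algebra \<Rightarrow> 'a)"
  by (rule bounded_linear_intro[where K=1]) (simp_all add: star_add star_scaleR)

lemma cscale_zero_right [simp]: "c *\<^sub>C (0::'a::unital_cstar_algebra) = 0"
  using cscale_add_right[of c "0::'a" 0] by simp

lemma cscale_minus_right: "c *\<^sub>C (- a) = - (c *\<^sub>C (a::'a::unital_cstar_algebra))"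
  using cscale_add_right[of c a "- a"] by (simp add: eq_neg_iff_add_eq_0 add.commute)

lemma cscale_diff_right: "c *\<^sub>C (a - b) = c *\<^sub>C a - c *\<^sub>C (b::'a::unital_cstar_algebra)"
  using cscale_add_right[of c a "- b"] by (simp add: cscale_minus_right)

lemma cscale_sum: "c *\<^sub>C sum f I = (\<Sum>i\<in>I. c *\<^sub>C (f i :: 'a::unital_cstar_algebra))"
  by (induction I rule: infinite_finite_induct) (simp_all add: cscale_add_right)

lemma cscale_one [simp]: "1 *\<^sub>C a = (a::'a::unital_cstar_algebra)"
  using cscale_of_real[of 1 a] by simp

lemma cscale_minus_left: "(- c) *\<^sub>C a = - (c *\<^sub>C (a::'a::unital_cstar_algebra))"
  using cscale_add_left[of c "- c" a] cscale_of_real[of 0 a]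
  by (simp add: eq_neg_iff_add_eq_0 add.commute)

lemma cscale_ii_ii: "\<i> *\<^sub>C \<i> *\<^sub>C a = - (a::'a::unital_cstar_algebra)"
  by (simp add: cscale_cscale cscale_minus_left)

section \<open>Neumann series and real spectra\<close>

lemma neumann_inverse:
  fixes x :: "'a::unital_cstar_algebra"
  assumes "norm x < 1"
  shows "\<exists>b. (1 - x) * b = 1 \<and> b * (1 - x) = 1"
proof -
  have sm: "summable (\<lambda>n. x ^ n)"
    by (rule summable_comparison_test'[where g="\<lambda>n. norm x ^ n" and N=0])
       (use assms in \<open>simp_all add: summable_geometric norm_power_le\<close>)
  define b where "b = (\<Sum>n. x ^ n)"
  have "b = 1 + (\<Sum>n. x ^ Suc n)"
    unfolding b_def using suminf_split_head[OF sm] by simp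
  moreover have "(\<Sum>n. x ^ Suc n) = x * b"
    unfolding b_def using suminf_mult[OF sm, of x] by simp
  moreover have "(\<Sum>n. x ^ Suc n) = b * x"
    unfolding b_def using suminf_mult2[OF sm, of x] by (simp add: power_commutes)
  ultimately have "b - x * b = 1" "b - b * x = 1" by (metis add_diff_cancel_right')+
  then show ?thesis by (intro exI[of _ b]) (simp add: algebra_simps)
qed

lemma shifted_inverse:
  fixes x :: "'a::unital_cstar_algebra"
  assumes "norm x < cmod c"
  shows "\<exists>b. (c *\<^sub>C 1 - x) * b = 1 \<and> b * (c *\<^sub>C 1 - x) = 1"
proof -
  have c: "c \<noteq> 0" using assms by auto
  have "norm (inverse c *\<^sub>C x) < 1"
    using assms c by (simp add: norm_cscale norm_inverse norm_divide field_simps)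
  then obtain b where b: "(1 - inverse c *\<^sub>C x) * b = 1" "b * (1 - inverse c *\<^sub>C x) = 1"
    using neumann_inverse by blast
  have eq: "c *\<^sub>C 1 - x = c *\<^sub>C (1 - inverse c *\<^sub>C x)"
    using c by (simp add: cscale_diff_right cscale_cscale)
  show ?thesis
    by (rule exI[of _ "inverse c *\<^sub>C b"])
       (use b c in \<open>simp add: eq cscale_mult_left cscale_mult_right cscale_cscale\<close>)
qed

text \<open>Arens' trick: shift the spectrum far along the imaginary axis. The norm of
  \<open>h + i t\<close> is at most sqrt(|h|^2 + t^2), whereas a spectral value with nonzero
  imaginary part would move to modulus |Im l + t|, which is larger for suitable
  \<open>t\<close>.\<close>

lemma selfadjoint_spectrum_real:
  fixes a :: "'a::unital_cstar_algebra"
  assumes sa: "star a = a" and l: "l \<in> cstar_spectrum a"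
  shows "Im l = 0"
proof (rule ccontr)
  assume im: "Im l \<noteq> 0"
  define h where "h = a - Re l *\<^sub>R 1"
  \<comment> \<open>Chosen so that \<open>Im l * t = (norm h)^2 + 1\<close>; the cross term of
    \<open>(Im l + t)^2\<close> then outweighs \<open>(norm h)^2\<close>.\<close>
  define t where "t = ((norm h)\<^sup>2 + 1) / Im l"
  have sh: "star h = h" unfolding h_def by (simp add: star_diff star_scaleR sa)
  have "star (h + (\<i> * t) *\<^sub>C 1) * (h + (\<i> * t) *\<^sub>C 1) = h * h + (t\<^sup>2) *\<^sub>R 1"
  proof -
    define w where "w = (\<i> * t) *\<^sub>C (1::'a)"
    have "star w = - w" by (simp add: w_def star_cscale cscale_minus_left)
    moreover have "w * h = h * w" by (simp add: w_def cscale_mult_left cscale_mult_right)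
    moreover have "w * w = - ((t\<^sup>2) *\<^sub>R 1)"
    proof -
      have "w * w = (\<i> * t * (\<i> * t)) *\<^sub>C 1"
        by (simp add: w_def cscale_mult_left cscale_cscale)
      also have "\<i> * t * (\<i> * t) = - complex_of_real (t\<^sup>2)"
        by (simp add: complex_eq_iff power2_eq_square)
      finally show ?thesis by (simp only: cscale_minus_left cscale_of_real)
    qed
    ultimately show ?thesis by (simp add: star_add sh algebra_simps flip: w_def)
  qed
  then have "(norm (h + (\<i> * t) *\<^sub>C 1))\<^sup>2 = norm (h * h + (t\<^sup>2) *\<^sub>R 1)"
    by (metis cstar_identity)
  also have "\<dots> \<le> (norm h)\<^sup>2 + t\<^sup>2"
  proof -
    have "norm ((t\<^sup>2) *\<^sub>R (1::'a)) \<le> t\<^sup>2"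
      using norm_one_le mult_left_mono[of "norm (1::'a)" 1 "t\<^sup>2"] by simp
    moreover have "norm (h * h) \<le> (norm h)\<^sup>2"
      by (simp add: norm_mult_ineq power2_eq_square)
    ultimately show ?thesis using norm_triangle_ineq[of "h * h"] by (smt (verit))
  qed
  also have "\<dots> < (Im l + t)\<^sup>2"
  proof -
    have "Im l * t = (norm h)\<^sup>2 + 1" using im by (simp add: t_def)
    then have "(Im l)\<^sup>2 + t\<^sup>2 + 2 * ((norm h)\<^sup>2 + 1) = (Im l + t)\<^sup>2"
      by (simp add: power2_sum)
    moreover have "(norm h)\<^sup>2 + t\<^sup>2 < (Im l)\<^sup>2 + t\<^sup>2 + 2 * ((norm h)\<^sup>2 + 1)"
      by (simp add: add_nonneg_pos)
    ultimately show ?thesis by (simp only:)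
  qed
  also have "\<dots> = (cmod (\<i> * (Im l + t)))\<^sup>2"
    by (simp add: norm_mult flip: of_real_add)
  finally have "norm (h + (\<i> * t) *\<^sub>C 1) < cmod (\<i> * (Im l + t))"
    by (rule power2_less_imp_less) simp
  then obtain b where b: "((\<i> * (Im l + t)) *\<^sub>C 1 - (h + (\<i> * t) *\<^sub>C 1)) * b = 1"
    "b * ((\<i> * (Im l + t)) *\<^sub>C 1 - (h + (\<i> * t) *\<^sub>C 1)) = 1"
    using shifted_inverse by blast
  have "l *\<^sub>C (1::'a) = Re l *\<^sub>R 1 + (\<i> * Im l) *\<^sub>C 1"
    by (metis complex_eq cscale_add_left cscale_of_real)
  then have "(\<i> * (Im l + t)) *\<^sub>C 1 - (h + (\<i> * t) *\<^sub>C 1) = - (a - l *\<^sub>C 1)"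
    by (simp add: h_def distrib_left cscale_add_left)
  with b have "(a - l *\<^sub>C 1) * (- b) = 1" "(- b) * (a - l *\<^sub>C 1) = 1"
    by (metis mult_minus_left mult_minus_right)+
  then show False using l unfolding cstar_spectrum_def by blast
qed

text \<open>
  By the spectral radius formula this is equivalent to \<^const>\<open>cstar_positive\<close>; the norm version
  makes it obvious that the positive elements form a cone, and lets square roots be obtained from
  the binomial series without spectral theory.
\<close>

definition norm_positive :: "'a::unital_cstar_algebra \<Rightarrow> bool" where
  "norm_positive a \<longleftrightarrow> star a = a \<and> (\<exists>t. norm (t *\<^sub>R 1 - a) \<le> t)"

section \<open>The cone of norm-positive elements\<close>

lemma norm_positive_selfadjoint: "norm_positive a \<Longrightarrow> star a = a"
  by (simp add: norm_positive_def)

lemma norm_positive_zero [simp]: "norm_positive 0"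
  by (auto simp: norm_positive_def intro!: exI[of _ 0])

lemma norm_positive_add:
  assumes "norm_positive a" "norm_positive b"
  shows "norm_positive (a + b)"
proof -
  obtain s t where "norm (s *\<^sub>R 1 - a) \<le> s" "norm (t *\<^sub>R 1 - b) \<le> t"
    using assms by (auto simp: norm_positive_def)
  moreover have "(s + t) *\<^sub>R 1 - (a + b) = (s *\<^sub>R 1 - a) + (t *\<^sub>R 1 - b)"
    by (simp add: scaleR_left_distrib)
  ultimately have "norm ((s + t) *\<^sub>R 1 - (a + b)) \<le> s + t"
    by (metis norm_triangle_mono)
  then show ?thesis using assms by (auto simp: norm_positive_def star_add)
qed

lemma norm_positive_sum:
  "(\<And>i. i \<in> I \<Longrightarrow> norm_positive (f i)) \<Longrightarrow> norm_positive (sum f I)"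
  by (induction I rule: infinite_finite_induct) (auto intro: norm_positive_add)

lemma norm_positive_scaleR:
  assumes "norm_positive a" "0 \<le> r"
  shows "norm_positive (r *\<^sub>R a)"
proof -
  obtain t where "norm (t *\<^sub>R 1 - a) \<le> t" using assms by (auto simp: norm_positive_def)
  then have "norm ((r * t) *\<^sub>R 1 - r *\<^sub>R a) \<le> r * t"
    using assms(2) mult_left_mono[of _ t r]
    by (metis abs_of_nonneg norm_scaleR scaleR_diff_right scaleR_scaleR)
  then show ?thesis using assms(1) by (auto simp: norm_positive_def star_scaleR)
qed

text \<open>With \<open>t\<close> the witness for \<open>a\<close>, the sum is
  \<open>(t + r) 1 - (t 1 - a)\<close>, whose second part has norm at most \<open>t\<close>, less
  than \<open>t + r\<close>; the Neumann series applies.\<close>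

lemma norm_positive_shift_inverse:
  assumes a: "norm_positive a" and r: "0 < r"
  shows "\<exists>b. (r *\<^sub>R 1 + a) * b = 1 \<and> b * (r *\<^sub>R 1 + a) = 1"
proof -
  obtain t where t: "norm (t *\<^sub>R 1 - a) \<le> t" using a by (auto simp: norm_positive_def)
  then have "0 \<le> t" using norm_ge_zero order_trans by blast
  then have "norm (t *\<^sub>R 1 - a) < cmod (of_real (t + r))" using t r by (simp del: of_real_add)
  from shifted_inverse[OF this] show ?thesis
    by (simp add: cscale_of_real scaleR_left_distrib del: of_real_add)
qed

text \<open>Self-adjointness makes the spectrum real, and the shift lemma makes \<open>a - l\<close>
  invertible for negative \<open>l\<close>. This is the bridge from \<open>norm_positive\<close> to
  the positivity demanded of an inner product.\<close>

lemma norm_positive_imp_cstar_positive: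
  assumes "norm_positive a"
  shows "cstar_positive a"
  unfolding cstar_positive_def
proof
  show sa: "star a = a" using assms by (rule norm_positive_selfadjoint)
  show "cstar_spectrum a \<subseteq> complex_of_real ` {0..}"
  proof
    fix l assume l: "l \<in> cstar_spectrum a"
    have re: "l = complex_of_real (Re l)"
      using selfadjoint_spectrum_real[OF sa l] by (simp add: complex_eq_iff)
    have "\<not> Re l < 0"
    proof
      assume "Re l < 0"
      then obtain b where "(- Re l *\<^sub>R 1 + a) * b = 1" "b * (- Re l *\<^sub>R 1 + a) = 1"
        using norm_positive_shift_inverse[OF assms, of "- Re l"] by auto
      moreover have "- Re l *\<^sub>R 1 + a = a - l *\<^sub>C 1"
        by (subst re) (simp add: cscale_of_real)
      ultimately show False using l unfolding cstar_spectrum_def by auto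
    qed
    then show "l \<in> complex_of_real ` {0..}" using re by (metis atLeast_iff image_eqI not_less)
  qed
qed

section \<open>Square roots and positivity of \<open>a* a\<close>\<close>

text \<open>Taylor coefficients at 0 of sqrt(1 - x).\<close>

definition sqrt_coeff :: "nat \<Rightarrow> real" where
  "sqrt_coeff n = (- 1) ^ n * ((1/2) gchoose n)"

lemma sqrt_coeff_0 [simp]: "sqrt_coeff 0 = 1"
  by (simp add: sqrt_coeff_def)

text \<open>An alternating partial sum of binomial coefficients is again a single one, (-1)^n (-1/2
  choose n). Negating the upper index turns it into (n - 1/2 choose n), a product of nonnegative
  factors over n!.\<close>

lemma sqrt_coeff_partial_sum_nonneg: "0 \<le> (\<Sum>k\<le>n. sqrt_coeff k)"
proof -
  have "(\<Sum>k\<le>n. sqrt_coeff k) = (- 1) ^ n * ((- (1/2::real)) gchoose n)"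
    using gbinomial_sum_lower_neg[of "1/2::real" n] by (simp add: sqrt_coeff_def mult.commute)
  also have "\<dots> = ((1/2 + real n - 1) gchoose n)"
    by (simp add: gbinomial_minus flip: power_mult_distrib mult.assoc)
  also have "\<dots> \<ge> 0"
    by (auto simp: gbinomial_prod_rev intro!: divide_nonneg_pos prod_nonneg)
  finally show ?thesis .
qed

lemma sqrt_coeff_Suc_nonpos: "sqrt_coeff (Suc n) \<le> 0"
proof -
  have "sqrt_coeff (Suc n) = (- 1) ^ Suc n * ((1/2) * (((1/2) - 1) gchoose n)) / real (Suc n)"
    using gbinomial_absorption'[of "Suc n" "1/2::real"] by (simp add: sqrt_coeff_def)
  also have "((1/2::real) - 1) gchoose n = (- 1) ^ n * ((1/2 + real n - 1) gchoose n)"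
    by (simp add: gbinomial_minus flip: power_mult_distrib mult.assoc)
  also have "(- 1) ^ Suc n * ((1/2) * ((- 1) ^ n * ((1/2 + real n - 1) gchoose n))) / real (Suc n)
      = - ((1/2 + real n - 1) gchoose n) / (2 * real (Suc n))"
    by (simp flip: power_mult_distrib mult.assoc)
  also have "\<dots> \<le> 0"
    by (auto simp: gbinomial_prod_rev intro!: divide_nonneg_pos prod_nonneg)
  finally show ?thesis .
qed

text \<open>All coefficients after the first are nonpositive, so the absolute sum is 1 minus a
  nonnegative partial sum. The bound 1 yields both convergence on the closed unit ball and the
  positivity witness for the root.\<close>

lemma sqrt_coeff_abs_sum_le: "(\<Sum>n<N. \<bar>sqrt_coeff (Suc n)\<bar>) \<le> 1"
proof -
  have "(\<Sum>n<N. \<bar>sqrt_coeff (Suc n)\<bar>) = - (\<Sum>n<N. sqrt_coeff (Suc n))"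
    by (simp add: abs_of_nonpos sqrt_coeff_Suc_nonpos sum_negf)
  also have "\<dots> = 1 - (\<Sum>k\<le>N. sqrt_coeff k)"
    by (simp add: sum.lessThan_Suc_shift flip: lessThan_Suc_atMost del: sum.lessThan_Suc)
  finally show ?thesis using sqrt_coeff_partial_sum_nonneg[of N] by simp
qed

text \<open>Vandermonde's identity for 1/2 + 1/2 = 1: squaring the series gives the coefficients of
  1 - x, which vanish from n = 2 on.\<close>

lemma sqrt_coeff_convolution:
  "(\<Sum>i\<le>n. sqrt_coeff i * sqrt_coeff (n - i)) = (- 1) ^ n * (1 gchoose n)"
proof -
  have "(\<Sum>i\<le>n. sqrt_coeff i * sqrt_coeff (n - i))
      = (\<Sum>i\<le>n. (- 1) ^ n * (((1/2) gchoose i) * ((1/2) gchoose (n - i))))"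
  proof (rule sum.cong)
    fix i assume "i \<in> {..n}"
    then have "(- 1 :: real) ^ n = (- 1) ^ i * (- 1) ^ (n - i)"
      by (simp flip: power_add)
    then show "sqrt_coeff i * sqrt_coeff (n - i)
        = (- 1) ^ n * (((1/2) gchoose i) * ((1/2) gchoose (n - i)))"
      by (simp add: sqrt_coeff_def)
  qed simp
  also have "\<dots> = (- 1) ^ n * (1 gchoose n)"
    using gbinomial_Vandermonde[of "1/2::real" "1/2" n]
    by (simp add: atMost_atLeast0 flip: sum_distrib_left)
  finally show ?thesis .
qed

text \<open>The root is the binomial series of sqrt(1 - x) at \<open>x\<close>. Being a limit of
  polynomials in \<open>x\<close>, it commutes with everything that commutes with
  \<open>x\<close>.\<close>

lemma norm_positive_sqrt_near_one:
  fixes x :: "'a::unital_cstar_algebra"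
  assumes sa: "star x = x" and x: "norm x \<le> 1"
  shows "\<exists>y. norm_positive y \<and> y * y = 1 - x \<and> (\<forall>b. x * b = b * x \<longrightarrow> y * b = b * y)"
proof -
  define f where "f n = sqrt_coeff n *\<^sub>R x ^ n" for n
  have abs_sm: "summable (\<lambda>n. \<bar>sqrt_coeff (Suc n)\<bar>)"
    by (rule bounded_imp_summable[where B=1])
       (use sqrt_coeff_abs_sum_le in \<open>simp_all flip: lessThan_Suc_atMost del: sum.lessThan_Suc\<close>)
  have norm_f: "norm (f n) \<le> \<bar>sqrt_coeff n\<bar>" for n
  proof -
    have "norm (x ^ n) \<le> 1"
      using norm_power_le[of x n] power_le_one[OF norm_ge_zero x, of n] by linarith
    then show ?thesis by (simp add: f_def mult_left_le)
  qed
  have nsm: "summable (\<lambda>n. norm (f n))"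
    by (rule summable_comparison_test'[where g="\<lambda>n. \<bar>sqrt_coeff n\<bar>" and N=0])
       (use abs_sm norm_f summable_Suc_iff[of "\<lambda>n. \<bar>sqrt_coeff n\<bar>"] in simp_all)
  then have sm: "summable f" by (rule summable_norm_cancel)
  define y where "y = suminf f"
  have conv: "(\<Sum>i\<le>n. f i * f (n - i)) = ((- 1) ^ n * (1 gchoose n)) *\<^sub>R x ^ n" for n
  proof -
    have "(\<Sum>i\<le>n. f i * f (n - i)) = (\<Sum>i\<le>n. (sqrt_coeff i * sqrt_coeff (n - i)) *\<^sub>R x ^ n)"
      by (rule sum.cong) (auto simp: f_def simp flip: power_add)
    then show ?thesis by (simp add: sqrt_coeff_convolution flip: scaleR_sum_left)
  qed
  have zero: "((- 1) ^ n * (1 gchoose n :: real)) *\<^sub>R x ^ n = 0" if "n \<notin> {0, 1}" for n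
  proof -
    have "(1::real) gchoose n = of_nat (1 choose n)"
      using binomial_gbinomial[of 1 n, where 'a=real] by simp
    also have "1 choose n = 0" using that by (intro binomial_eq_0) auto
    finally show ?thesis by simp
  qed
  have yy: "y * y = 1 - x"
  proof -
    have "y * y = (\<Sum>n. \<Sum>i\<le>n. f i * f (n - i))"
      unfolding y_def by (rule Cauchy_product[OF nsm nsm])
    also have "\<dots> = (\<Sum>n\<in>{0,1}. ((- 1) ^ n * (1 gchoose n)) *\<^sub>R x ^ n)"
      unfolding conv by (rule suminf_finite) (use zero in auto)
    finally show ?thesis by simp
  qed
  have sy: "star y = y"
  proof -
    have "star (f n) = f n" for n by (simp add: f_def star_scaleR star_power sa)
    then show ?thesis
      using bounded_linear.suminf[OF bounded_linear_star sm] by (simp add: y_def)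
  qed
  \<comment> \<open>Makes 1 the scalar \<open>t\<close> required by \<open>norm_positive y\<close>:
    the leading term of the series cancels.\<close>
  have "norm (1 *\<^sub>R 1 - y) \<le> 1"
  proof -
    have "y = 1 + (\<Sum>n. f (Suc n))"
      unfolding y_def using suminf_split_head[OF sm] by (simp add: f_def)
    then have "norm (1 *\<^sub>R 1 - y) = norm (\<Sum>n. f (Suc n))" by (simp add: norm_minus_cancel)
    also have "\<dots> \<le> (\<Sum>n. \<bar>sqrt_coeff (Suc n)\<bar>)"
      by (rule norm_suminf_le[OF norm_f abs_sm])
    also have "\<dots> \<le> 1"
      by (rule suminf_le_const[OF abs_sm sqrt_coeff_abs_sum_le])
    finally show ?thesis .
  qed
  then have "norm_positive y" using sy unfolding norm_positive_def by blast
  moreover have "y * b = b * y" if "x * b = b * x" for b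
  proof -
    have "x ^ n * b = b * x ^ n" for n
      by (induction n) (simp_all add: mult.assoc that, metis mult.assoc that)
    then have "f n * b = b * f n" for n by (simp add: f_def)
    then show ?thesis
      using suminf_mult[OF sm, of b] suminf_mult2[OF sm, of b] by (simp add: y_def)
  qed
  ultimately show ?thesis using yy by blast
qed

text \<open>The witness \<open>t\<close> rescales: \<open>x = 1 - a / t\<close> has norm at most 1,
  and \<open>sqrt t\<close> times a root of \<open>1 - x\<close> is a root of \<open>a\<close>. The
  commutation clause later makes roots of commuting elements commute.\<close>

lemma norm_positive_sqrt:
  fixes a :: "'a::unital_cstar_algebra"
  assumes "norm_positive a"
  obtains y where "norm_positive y" "y * y = a" "\<And>b. a * b = b * a \<Longrightarrow> y * b = b * y"
proof -
  obtain t where t: "norm (t *\<^sub>R 1 - a) \<le> t" and sa: "star a = a"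
    using assms by (auto simp: norm_positive_def)
  then have "0 \<le> t" using norm_ge_zero order_trans by blast
  then consider "t = 0" | "0 < t" by linarith
  then show ?thesis
  proof cases
    case 1
    then have "a = 0" using t by simp
    then show ?thesis using that[of 0] by simp
  next
    case 2
    define x where "x = 1 - inverse t *\<^sub>R a"
    have "x = inverse t *\<^sub>R (t *\<^sub>R 1 - a)" using 2 by (simp add: x_def scaleR_diff_right)
    then have "norm x = norm (t *\<^sub>R 1 - a) / t" using 2 by (simp add: divide_inverse_commute)
    then have "norm x \<le> 1" using t 2 by simp
    moreover have "star x = x" by (simp add: x_def star_diff star_scaleR sa)
    ultimately obtain y where y: "norm_positive y" "y * y = 1 - x"
      "\<And>b. x * b = b * x \<Longrightarrow> y * b = b * y"
      using norm_positive_sqrt_near_one by blast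
    show ?thesis
    proof (rule that[of "sqrt t *\<^sub>R y"])
      show "norm_positive (sqrt t *\<^sub>R y)" using y(1) 2 by (simp add: norm_positive_scaleR)
      show "sqrt t *\<^sub>R y * sqrt t *\<^sub>R y = a" using y(2) 2 by (simp add: x_def flip: mult.assoc)
    next
      fix b assume "a * b = b * a"
      then have "x * b = b * x" by (simp add: x_def algebra_simps)
      then show "sqrt t *\<^sub>R y * b = b * sqrt t *\<^sub>R y" using y(3) by simp
    qed
  qed
qed

text \<open>
  The element \<open>b + \<i> c\<close> is \<open>sqrt t\<close> times a unitary, which bounds its imaginary part.
\<close>

lemma sum_squares_eq_imp_norm_le:
  fixes b c :: "'a::unital_cstar_algebra"
  assumes sb: "star b = b" and sc: "star c = c" and comm: "b * c = c * b"
    and eq: "b * b + c * c = t *\<^sub>R 1"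
  shows "norm (c * c) \<le> \<bar>t\<bar>"
proof -
  define u where "u = b + \<i> *\<^sub>C c"
  have "star u * u = b * b + c * c"
    by (simp add: u_def star_add star_cscale sb sc cscale_mult_left cscale_mult_right
        cscale_minus_left cscale_ii_ii cscale_diff_right algebra_simps comm)
  then have "(norm u)\<^sup>2 = norm (t *\<^sub>R (1::'a))" by (metis cstar_identity eq)
  then have u: "(norm u)\<^sup>2 \<le> \<bar>t\<bar>" using norm_one_le mult_left_le[of "norm (1::'a)" "\<bar>t\<bar>"] by simp
  have "(2 * \<i>) *\<^sub>C c = u - star u"
    by (simp add: u_def star_add star_cscale sb sc cscale_minus_left)
       (metis cscale_add_left mult_2)
  then have "norm ((2 * \<i>) *\<^sub>C c) \<le> 2 * norm u"
    using norm_triangle_ineq4[of u "star u"] by simp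
  then have "norm c \<le> norm u" by (simp add: norm_cscale norm_mult)
  then have "(norm c)\<^sup>2 \<le> (norm u)\<^sup>2" by (simp add: power_mono)
  moreover have "norm (c * c) = (norm c)\<^sup>2" using cstar_identity[of c] by (simp add: sc)
  ultimately show ?thesis using u by linarith
qed

text \<open>For \<open>t = norm (y * y)\<close>, the element \<open>t 1 - y * y\<close> is positive
  with witness \<open>t\<close> itself, so it has a root \<open>c\<close> commuting with
  \<open>y\<close>. As \<open>y * y + c * c = t 1\<close>, the norm of \<open>c * c\<close> is at
  most \<open>t\<close>. The estimate makes \<open>t\<close> a witness for the positivity of
  \<open>y * y\<close>.\<close>

lemma selfadjoint_square_bound:
  fixes y :: "'a::unital_cstar_algebra"
  assumes sy: "star y = y"
  shows "norm (norm (y * y) *\<^sub>R 1 - y * y) \<le> norm (y * y)"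
proof -
  define t where "t = norm (y * y)"
  have "norm_positive (t *\<^sub>R 1 - y * y)"
    unfolding norm_positive_def
    by (intro conjI exI[of _ t]) (simp_all add: star_diff star_scaleR star_mult sy t_def)
  then obtain c where c: "norm_positive c" "c * c = t *\<^sub>R 1 - y * y"
    "\<And>b. (t *\<^sub>R 1 - y * y) * b = b * (t *\<^sub>R 1 - y * y) \<Longrightarrow> c * b = b * c"
    by (rule norm_positive_sqrt) blast
  have "c * y = y * c" by (rule c(3)) (simp add: algebra_simps)
  then have "norm (c * c) \<le> \<bar>t\<bar>"
    using c(1,2) by (intro sum_squares_eq_imp_norm_le[OF sy]) (simp_all add: norm_positive_selfadjoint)
  then show ?thesis using c(2) by (simp add: t_def)
qed

lemma norm_positive_square: "star y = y \<Longrightarrow> norm_positive (y * y)"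
  unfolding norm_positive_def using selfadjoint_square_bound[of y] star_mult[of y y] by auto

text \<open>For \<open>s = norm (a + b)\<close>, the element \<open>s 1 - (a + b)\<close> is
  positive and, after adding \<open>b\<close>, so is \<open>s 1 - a\<close>. The roots of
  \<open>a\<close> and of \<open>s 1 - a\<close> commute and their squares add up to
  \<open>s 1\<close>, which bounds \<open>norm a\<close> by \<open>s\<close>.\<close>

lemma norm_positive_le_norm_add:
  assumes a: "norm_positive a" and b: "norm_positive b"
  shows "norm a \<le> norm (a + b)"
proof -
  define s where "s = norm (a + b)"
  have ab: "norm_positive (a + b)" using a b by (rule norm_positive_add)
  have "norm_positive (s *\<^sub>R 1 - (a + b))"
    unfolding norm_positive_def using norm_positive_selfadjoint[OF ab]
    by (intro conjI exI[of _ s]) (simp_all add: star_diff star_scaleR s_def add.commute)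
  from norm_positive_add[OF this b] have d: "norm_positive (s *\<^sub>R 1 - a)" by simp
  obtain y where y: "norm_positive y" "y * y = a" "\<And>z. a * z = z * a \<Longrightarrow> y * z = z * y"
    using norm_positive_sqrt[OF a] by blast
  obtain w where w: "norm_positive w" "w * w = s *\<^sub>R 1 - a"
    "\<And>z. (s *\<^sub>R 1 - a) * z = z * (s *\<^sub>R 1 - a) \<Longrightarrow> w * z = z * w"
    using norm_positive_sqrt[OF d] by blast
  have "a * y = y * a" by (simp flip: y(2) add: mult.assoc)
  then have "w * y = y * w" by (intro w(3)) (simp add: algebra_simps)
  then have "norm (y * y) \<le> \<bar>s\<bar>"
    using y(1,2) w(1,2) by (intro sum_squares_eq_imp_norm_le[of w y]) (simp_all add: norm_positive_selfadjoint)
  then show ?thesis by (simp add: y(2) s_def)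
qed

section \<open>Order properties of the cone\<close>

lemma norm_positive_antisym:
  assumes "norm_positive a" "norm_positive (- a)"
  shows "a = 0"
  using norm_positive_le_norm_add[OF assms] by simp

lemma norm_positive_sum_eq_0:
  assumes "finite I" "\<And>i. i \<in> I \<Longrightarrow> norm_positive (f i)" "sum f I = 0" "i \<in> I"
  shows "f i = 0"
proof -
  have "norm_positive (sum f (I - {i}))" using assms(2) by (intro norm_positive_sum) auto
  moreover have "sum f (I - {i}) = - f i"
    using assms(1,3,4) by (simp add: sum.remove eq_neg_iff_add_eq_0 add.commute)
  ultimately show ?thesis using assms(2,4) norm_positive_antisym[of "f i"] by simp
qed

text \<open>The product is the square of \<open>y * w\<close>, which is self-adjoint because the
  roots \<open>y\<close> and \<open>w\<close> commute.\<close>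

lemma norm_positive_mult:
  assumes a: "norm_positive a" and b: "norm_positive b" and comm: "a * b = b * a"
  shows "norm_positive (a * b)"
proof -
  obtain y where y: "norm_positive y" "y * y = a" "\<And>z. a * z = z * a \<Longrightarrow> y * z = z * y"
    using norm_positive_sqrt[OF a] by blast
  obtain w where w: "norm_positive w" "w * w = b" "\<And>z. b * z = z * b \<Longrightarrow> w * z = z * w"
    using norm_positive_sqrt[OF b] by blast
  have "y * b = b * y" using y(3) comm by simp
  then have wy: "w * y = y * w" using w(3) by simp
  then have "a * b = (y * w) * (y * w)" by (metis mult.assoc y(2) w(2))
  moreover have "star (y * w) = y * w"
    using y(1) w(1) wy by (simp add: star_mult norm_positive_selfadjoint)
  ultimately show ?thesis using norm_positive_square by metis
qed

text \<open>Twice the sum is \<open>x * x + y * y\<close>, where the self-adjoint \<open>x\<close>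
  and \<open>y\<close> are, up to sign, twice the real and imaginary parts of
  \<open>b\<close>.\<close>

lemma norm_positive_star_mult_plus_mult_star:
  fixes b :: "'a::unital_cstar_algebra"
  shows "norm_positive (star b * b + b * star b)"
proof -
  define x where "x = (b + star b)"
  define y where "y = \<i> *\<^sub>C (b - star b)"
  have "star x = x" by (simp add: x_def star_add star_star add.commute)
  moreover have "star y = y"
    by (simp add: y_def star_cscale star_diff star_star cscale_minus_left cscale_diff_right)
  ultimately have "norm_positive ((1/2) *\<^sub>R (x * x + y * y))"
    by (intro norm_positive_scaleR norm_positive_add norm_positive_square) auto
  moreover have "x * x + y * y = 2 *\<^sub>R (star b * b + b * star b)"
  proof -
    have "y * y = - ((b - star b) * (b - star b))"
      unfolding y_def by (simp only: cscale_mult_left cscale_mult_right cscale_ii_ii)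
    then show ?thesis by (simp add: x_def scaleR_2 algebra_simps)
  qed
  ultimately show ?thesis by simp
qed

text \<open>
  If \<open>p = - b* b = r\<^sup>2\<close> is positive, then so is \<open>q = b b*\<close>. For \<open>c = b r\<close> both \<open>c* c = - p\<^sup>2\<close> and
  \<open>c c* = - q\<^sup>2\<close> are negative, although their sum is positive.
\<close>

lemma norm_positive_minus_star_mult_imp_0:
  fixes b :: "'a::unital_cstar_algebra"
  assumes p: "norm_positive (- (star b * b))"
  shows "b = 0"
proof -
  define p where "p = - (star b * b)"
  define q where "q = b * star b"
  obtain r where r: "norm_positive r" "r * r = p"
    using norm_positive_sqrt[OF assms] unfolding p_def by blast
  have sr: "star r = r" using r by (simp add: norm_positive_selfadjoint)
  define c where "c = b * r"
  have "star c * c = r * (star b * b) * r" by (simp add: c_def star_mult sr mult.assoc)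
  also have "\<dots> = - (r * p * r)" by (simp add: p_def)
  also have "\<dots> = - (p * p)" by (simp flip: r(2) add: mult.assoc)
  finally have cc: "star c * c = - (p * p)" .
  have "c * star c = b * (r * r) * star b" by (simp add: c_def star_mult sr mult.assoc)
  also have "\<dots> = - (q * q)" by (simp add: r(2) p_def q_def mult.assoc)
  finally have cc': "c * star c = - (q * q)" .
  have sp: "star p = p" by (simp add: p_def star_minus star_mult star_star)
  have sq: "star q = q" by (simp add: q_def star_mult star_star)
  have pp: "norm_positive (p * p)" and qq: "norm_positive (q * q)"
    using sp sq by (simp_all add: norm_positive_square)
  have "norm_positive (- (p * p + q * q))"
    using norm_positive_star_mult_plus_mult_star[of c] by (simp add: cc cc')
  then have "p * p + q * q = 0"
    using norm_positive_antisym norm_positive_add[OF pp qq] by blast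
  then have "- (p * p) = q * q" by (rule minus_unique)
  then have "p * p = 0" using norm_positive_antisym[OF pp] qq by simp
  then have "p = 0" using mult_star_self_eq_0_iff[of p] sp by simp
  then show ?thesis using mult_star_self_eq_0_iff[of b] by (simp add: p_def)
qed

text \<open>
  With \<open>h = a* a\<close> and \<open>n = |h| - h\<close>, one has \<open>h n = - |h| n\<close>, so that \<open>b = a n\<close> satisfies
  \<open>b* b = - |h| n\<^sup>2 \<le> 0\<close> and therefore vanishes.
\<close>

lemma norm_positive_star_mult:
  fixes a :: "'a::unital_cstar_algebra"
  shows "norm_positive (star a * a)"
proof -
  define h where "h = star a * a"
  have sh: "star h = h" by (simp add: h_def star_mult star_star)
  obtain m where m: "norm_positive m" "m * m = h * h"
    "\<And>b. (h * h) * b = b * (h * h) \<Longrightarrow> m * b = b * m"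
    using norm_positive_sqrt[OF norm_positive_square[OF sh]] by blast
  have mh: "m * h = h * m" by (rule m(3)) (simp add: mult.assoc)
  define n where "n = m - h"
  have sn: "star n = n" using m(1) by (simp add: n_def star_diff sh norm_positive_selfadjoint)
  have mn: "m * n = n * m" by (simp add: n_def algebra_simps mh)
  have hn: "h * n = - (m * n)" by (simp add: n_def algebra_simps mh m(2))
  have nh: "n * h = h * n" by (simp add: n_def algebra_simps mh)
  have "star (a * n) * (a * n) = n * h * n" by (simp add: h_def star_mult sn mult.assoc)
  also have "\<dots> = - (m * (n * n))" by (simp add: nh hn mult.assoc)
  finally have eq: "- (star (a * n) * (a * n)) = m * (n * n)" by simp
  have "norm_positive (m * (n * n))"
    by (rule norm_positive_mult[OF m(1) norm_positive_square[OF sn]]) (metis mn mult.assoc)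
  then have "a * n = 0" using norm_positive_minus_star_mult_imp_0[of "a * n"] eq by simp
  then have "h * n = 0" by (simp add: h_def mult.assoc)
  \<comment> \<open>Since \<open>h * n = - (m * n)\<close>, both products vanish, and with them
    \<open>(m - h) * n\<close>.\<close>
  then have "n * n = 0" using hn left_diff_distrib[of m h n] by (simp flip: n_def)
  then have "n = 0" using mult_star_self_eq_0_iff[of n] sn by simp
  then show ?thesis using m(1) by (simp add: n_def h_def)
qed

lemma norm_positive_mult_star: "norm_positive (a * star (a::'a::unital_cstar_algebra))"
  using norm_positive_star_mult[of "star a"] by (simp add: star_star)

section \<open>Orthogonal sections and existence of the inner product\<close>

context left_module
begin

lemma scale_zero_left [simp]: "scale 0 x = 0"
  using scale_add_left[of 0 0 x] by simp

lemma scale_zero_right [simp]: "scale a 0 = 0"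
  using scale_add_right[of a 0 0] by simp

lemma scale_diff_left: "scale (a - b) x = scale a x - scale b x"
  using scale_add_left[of "a - b" b x] by simp

lemma scale_sum_left: "scale (sum f I) x = (\<Sum>i\<in>I. scale (f i) x)"
  by (induction I rule: infinite_finite_induct) (simp_all add: scale_add_left)

lemma scale_sum_right: "scale a (sum f I) = (\<Sum>i\<in>I. scale a (f i))"
  by (induction I rule: infinite_finite_induct) (simp_all add: scale_add_right)

lemma sum_scale_Kronecker:
  "finite I \<Longrightarrow> i \<in> I \<Longrightarrow> (\<Sum>j\<in>I. scale (if j = i then 1 else 0) (x j)) = x i"
  by (simp add: if_distrib[of "\<lambda>a. scale a _"] scale_one cong: if_cong)

end

section \<open>The standard A-valued inner product on rows\<close>

definition row_inner :: "'i set \<Rightarrow> ('i \<Rightarrow> 'a::unital_cstar_algebra) \<Rightarrow> ('i \<Rightarrow> 'a) \<Rightarrow> 'a" where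
  "row_inner I v w = (\<Sum>i\<in>I. v i * star (w i))"

lemma star_row_inner: "star (row_inner I v w) = row_inner I w v"
  by (simp add: row_inner_def star_sum star_mult star_star)

lemma row_inner_add_left: "row_inner I (\<lambda>i. u i + v i) w = row_inner I u w + row_inner I v w"
  by (simp add: row_inner_def distrib_right sum.distrib)

lemma row_inner_diff_left: "row_inner I (\<lambda>i. u i - v i) w = row_inner I u w - row_inner I v w"
  by (simp add: row_inner_def left_diff_distrib sum_subtractf)

lemma row_inner_diff_right: "row_inner I w (\<lambda>i. u i - v i) = row_inner I w u - row_inner I w v"
  by (simp add: row_inner_def star_diff right_diff_distrib sum_subtractf)

lemma row_inner_mult_left: "row_inner I (\<lambda>i. a * v i) w = a * row_inner I v w"
  by (simp add: row_inner_def sum_distrib_left mult.assoc)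

lemma row_inner_Kronecker:
  "finite I \<Longrightarrow> i \<in> I \<Longrightarrow> row_inner I v (\<lambda>j. if j = i then 1 else 0) = v i"
  by (simp add: row_inner_def if_distrib[of star] if_distrib[of "\<lambda>a. _ * a"] cong: if_cong)

lemma norm_positive_row_inner: "norm_positive (row_inner I v v)"
  unfolding row_inner_def by (intro norm_positive_sum norm_positive_mult_star)

lemma row_inner_self_eq_0:
  assumes "finite I" "row_inner I v v = 0" "i \<in> I"
  shows "v i = 0"
proof -
  have "v i * star (v i) = 0"
    using assms unfolding row_inner_def
    by (intro norm_positive_sum_eq_0[where f = "\<lambda>i. v i * star (v i)"] norm_positive_mult_star)
  then show ?thesis using mult_star_self_eq_0_iff[of "star (v i)"] by (metis star_star star_zero)
qed

text \<open>The other summands form a positive element, and adding one does not decrease the norm.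
  Thus Cauchy sequences of rows are Cauchy in each coordinate.\<close>

lemma norm_le_row_inner:
  assumes "finite I" "i \<in> I"
  shows "(norm (v i))\<^sup>2 \<le> norm (row_inner I v v)"
proof -
  have "row_inner I v v = v i * star (v i) + row_inner (I - {i}) v v"
    using assms by (simp add: row_inner_def sum.remove)
  then show ?thesis
    using norm_positive_le_norm_add[OF norm_positive_mult_star norm_positive_row_inner]
    by (metis cstar_identity')
qed

text \<open>
  Adding the vectors \<open>t l\<close> one at a time, the Sherman--Morrison formula inverts each rank one update;
  its denominator \<open>1 + \<langle>u, t l\<rangle>\<close> is invertible because \<open>\<langle>u, t l\<rangle>\<close> is a sum of elements \<open>a a*\<close>.
\<close>

lemma id_plus_finite_rank_surj:
  fixes t :: "'l \<Rightarrow> 'i \<Rightarrow> 'a::unital_cstar_algebra"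
  assumes "finite J"
  shows "\<exists>v. \<forall>i. v i + (\<Sum>l\<in>J. row_inner I v (t l) * t l i) = w i"
  using assms
proof (induction J arbitrary: w rule: finite_induct)
  case empty
  show ?case by (intro exI[of _ w]) simp
next
  case (insert m J)
  obtain u where u: "\<And>i. u i + (\<Sum>l\<in>J. row_inner I u (t l) * t l i) = t m i"
    using insert.IH[of "t m"] by blast
  obtain y where y: "\<And>i. y i + (\<Sum>l\<in>J. row_inner I y (t l) * t l i) = w i"
    using insert.IH[of w] by blast
  define \<alpha> where "\<alpha> = row_inner I u (t m)"
  \<comment> \<open>Replacing \<open>t m\<close> by its expression in \<open>u\<close> turns
    \<open>star \<alpha>\<close> into a sum of visibly positive terms.\<close>
  have "\<alpha> = row_inner I u u + (\<Sum>l\<in>J. row_inner I u (t l) * star (row_inner I u (t l)))"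
  proof -
    have "star \<alpha> = row_inner I (\<lambda>i. u i + (\<Sum>l\<in>J. row_inner I u (t l) * t l i)) u"
      by (simp add: \<alpha>_def star_row_inner u)
    also have "\<dots> = row_inner I u u + row_inner I (\<lambda>i. \<Sum>l\<in>J. row_inner I u (t l) * t l i) u"
      by (rule row_inner_add_left)
    also have "row_inner I (\<lambda>i. \<Sum>l\<in>J. row_inner I u (t l) * t l i) u
        = (\<Sum>l\<in>J. row_inner I u (t l) * row_inner I (t l) u)"
      unfolding row_inner_def sum_distrib_right sum_distrib_left
      by (subst sum.swap) (simp add: mult.assoc)
    finally have "star (star \<alpha>)
        = star (row_inner I u u + (\<Sum>l\<in>J. row_inner I u (t l) * row_inner I (t l) u))" by simp
    then show ?thesis by (simp add: star_star star_add star_sum star_mult star_row_inner)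
  qed
  then have "norm_positive \<alpha>"
    by (simp add: norm_positive_add norm_positive_row_inner norm_positive_sum norm_positive_mult_star)
  then obtain \<beta> where \<beta>: "\<beta> * (1 + \<alpha>) = 1"
    using norm_positive_shift_inverse[of \<alpha> 1] by auto
  \<comment> \<open>For \<open>v = y - d * u\<close> the extra terms cancel once
    \<open>row_inner I v (t m) = d\<close>, that is,
    \<open>d * (1 + \<alpha>) = row_inner I y (t m)\<close>.\<close>
  define d where "d = row_inner I y (t m) * \<beta>"
  have d: "d + d * \<alpha> = row_inner I y (t m)"
  proof -
    have "\<beta> + \<beta> * \<alpha> = 1" using \<beta> by (simp add: distrib_left)
    then show ?thesis by (simp add: d_def mult.assoc flip: distrib_left)
  qed
  define v where "v i = y i - d * u i" for i
  have v: "row_inner I v z = row_inner I y z - d * row_inner I u z" for z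
    unfolding v_def by (simp add: row_inner_diff_left row_inner_mult_left)
  have "v i + (\<Sum>l\<in>insert m J. row_inner I v (t l) * t l i) = w i" for i
  proof -
    have "(\<Sum>l\<in>J. row_inner I v (t l) * t l i)
        = (\<Sum>l\<in>J. row_inner I y (t l) * t l i) - d * (\<Sum>l\<in>J. row_inner I u (t l) * t l i)"
      by (simp add: v left_diff_distrib sum_subtractf sum_distrib_left mult.assoc)
    also have "\<dots> = (w i - y i) - d * (t m i - u i)"
      by (simp flip: y[of i] u[of i])
    finally have J: "(\<Sum>l\<in>J. row_inner I v (t l) * t l i) = (w i - y i) - d * (t m i - u i)" .
    have "row_inner I v (t m) = d"
      using d by (simp add: v \<alpha>_def[symmetric] algebra_simps)
    then show ?thesis using insert.hyps J by (simp add: v_def algebra_simps)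
  qed
  then show ?case by blast
qed

text \<open>
  Kaplansky's trick: for the idempotent \<open>e = g F\<close> on rows and its adjoint \<open>e*\<close>, the operator
  \<open>z = 1 - (e* - e)\<^sup>2 = 1 + (e* - e) (e* - e)*\<close> is onto and satisfies \<open>e z = e e* e\<close>. Hence if
  \<open>z u = g m\<close>, then \<open>e* e u\<close> is mapped to \<open>m\<close>, and the range of \<open>e*\<close> is orthogonal to the kernel
  of \<open>e\<close>.
\<close>

lemma orthogonal_preimage:
  fixes s :: "'a::unital_cstar_algebra \<Rightarrow> 'm::ab_group_add \<Rightarrow> 'm"
    and x :: "'i \<Rightarrow> 'm" and g :: "'m \<Rightarrow> 'i \<Rightarrow> 'a"
  assumes s: "left_module s" and I: "finite I"
    and g_add: "\<And>m m' i. g (m + m') i = g m i + g m' i"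
    and g_scale: "\<And>a m i. g (s a m) i = a * g m i"
    and g_section: "\<And>m. (\<Sum>i\<in>I. s (g m i) (x i)) = m"
  shows "\<exists>t. (\<Sum>i\<in>I. s (t i) (x i)) = m \<and>
    (\<forall>v. (\<Sum>i\<in>I. s (v i) (x i)) = 0 \<longrightarrow> row_inner I t v = 0)"
proof -
  interpret left_module s by (rule s)
  define F where "F v = (\<Sum>i\<in>I. s (v i) (x i))" for v
  define e where "e v = g (F v)" for v
  define e' where "e' w i = row_inner I w (g (x i))" for w i
  define D where "D w i = e' w i - e w i" for w i
  \<comment> \<open>The matrix of \<open>D\<close>. Since \<open>D\<close> is skew-adjoint, the
    finite rank operator built from the rows \<open>C l\<close> is minus the square of
    \<open>D\<close>, so the surjectivity lemma solves \<open>u - D (D u) = g m\<close>.\<close>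
  define C where "C l i = star (g (x i) l) - g (x l) i" for l i
  have g_zero: "g 0 i = 0" for i using g_add[of 0 0 i] by simp
  have g_sum: "g (sum h J) i = (\<Sum>j\<in>J. g (h j) i)" for h :: "'i \<Rightarrow> 'm" and J i
    by (induction J rule: infinite_finite_induct) (simp_all add: g_add g_zero)
  have F_diff: "F (\<lambda>i. v i - w i) = F v - F w" for v w
    by (simp add: F_def scale_diff_left sum_subtractf)
  have Fg: "F (g m) = m" for m by (simp add: F_def g_section)
  have Fe: "F (e v) = F v" for v by (simp add: e_def Fg)
  have e_diff: "e (\<lambda>i. v i - w i) = (\<lambda>i. e v i - e w i)" for v w
  proof
    fix i
    have "g (F v - F w + F w) i = g (F v - F w) i + g (F w) i" by (rule g_add)
    then show "e (\<lambda>i. v i - w i) i = e v i - e w i" by (simp add: e_def F_diff)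
  qed
  have e'_diff: "e' (\<lambda>i. v i - w i) = (\<lambda>i. e' v i - e' w i)" for v w
    by (simp add: e'_def row_inner_diff_left fun_eq_iff)
  have e_apply: "e v i = (\<Sum>j\<in>I. v j * g (x j) i)" for v i
    by (simp add: e_def F_def g_sum g_scale)
  have adj: "row_inner I (e v) w = row_inner I v (e' w)" for v w
    unfolding e_apply e'_def row_inner_def star_sum star_mult star_star sum_distrib_left
      sum_distrib_right
    by (subst sum.swap) (simp add: mult.assoc)
  have e'_e': "e' (e' w) = e' w" for w
  proof
    fix i
    have "e' (e' w) i = star (row_inner I (g (x i)) (e' w))" by (simp add: e'_def star_row_inner)
    also have "\<dots> = star (row_inner I (e (g (x i))) w)" by (simp add: adj)
    also have "\<dots> = e' w i" by (simp add: e_def Fg e'_def star_row_inner)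
    finally show "e' (e' w) i = e' w i" .
  qed
  have D_apply: "D w i = (\<Sum>l\<in>I. w l * C l i)" for w i
    by (simp add: D_def C_def e_apply e'_def row_inner_def right_diff_distrib sum_subtractf)
  have row_C: "row_inner I v (C l) = - D v l" for v l
    by (simp add: D_def C_def e_apply e'_def row_inner_def right_diff_distrib sum_subtractf
        star_diff star_star)
  obtain u where "\<And>i. u i + (\<Sum>l\<in>I. row_inner I u (C l) * C l i) = g m i"
    using id_plus_finite_rank_surj[OF I] by blast
  then have u: "(\<lambda>i. u i - D (D u) i) = g m"
    by (simp add: row_C sum_negf D_apply[of "D u"] fun_eq_iff)
  have Du: "D u = (\<lambda>i. e' u i - e u i)" by (simp add: D_def fun_eq_iff)
  have DDu: "D (D u) = (\<lambda>i. (e' u i - e' (e u) i) - (e (e' u) i - e (e u) i))"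
    unfolding D_def[of "D u", abs_def] by (simp add: Du e_diff e'_diff e'_e')
  \<comment> \<open>As \<open>F (e v) = F v\<close>, the contributions of \<open>e' u\<close> and
    \<open>e (e' u)\<close> cancel.\<close>
  have "F (D (D u)) = F u - F (e' (e u))"
    unfolding DDu by (simp add: F_diff Fe)
  moreover have "F u - F (D (D u)) = m"
    using Fg[of m] by (simp add: u[symmetric] F_diff)
  ultimately have "F (e' (e u)) = m" by simp
  moreover have "row_inner I (e' (e u)) v = 0" if "F v = 0" for v
  proof -
    have "row_inner I (e' (e u)) v = star (row_inner I (e v) (e u))"
      by (simp add: adj star_row_inner)
    also have "e v = (\<lambda>_. 0)" by (simp add: e_def that g_zero fun_eq_iff)
    finally show ?thesis by (simp add: row_inner_def)
  qed
  ultimately show ?thesis unfolding F_def by blast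
qed

text \<open>Each \<open>m\<close> has exactly one preimage row under \<open>F\<close> that is
  orthogonal to the kernel of \<open>F\<close> and supported on the index set. This row depends
  linearly on \<open>m\<close>, and the inner product is pulled back along it from
  \<open>row_inner\<close>.\<close>

lemma exists_frame_inner_product:
  fixes s :: "'a::unital_cstar_algebra \<Rightarrow> 'm::ab_group_add \<Rightarrow> 'm"
  assumes s: "left_module s"
    and g_add: "\<And>m m' i. g (m + m') i = g m i + g m' i"
    and g_scale: "\<And>a m i. g (s a m) i = a * g m i"
    and g_section: "\<And>m. (\<Sum>i\<in>{1..k}. s (g m i) (x i)) = m"
  shows "\<exists>ip. frame_inner_product s k x ip"
proof -
  interpret left_module s by (rule s)
  define I where "I = {1..k}"
  have I: "finite I" by (simp add: I_def)
  define F where "F v = (\<Sum>i\<in>I. s (v i) (x i))" for v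
  \<comment> \<open>The clause off \<open>I\<close> pins the remaining entries, so that lifts are
    unique as functions.\<close>
  define lift where "lift m t \<longleftrightarrow> F t = m \<and> (\<forall>v. F v = 0 \<longrightarrow> row_inner I t v = 0) \<and>
    (\<forall>i. i \<notin> I \<longrightarrow> t i = 0)" for m t
  have F_add: "F (\<lambda>i. v i + w i) = F v + F w" for v w
    by (simp add: F_def scale_add_left sum.distrib)
  have F_diff: "F (\<lambda>i. v i - w i) = F v - F w" for v w
    by (simp add: F_def scale_diff_left sum_subtractf)
  have F_mult: "F (\<lambda>i. a * v i) = s a (F v)" for a v
    by (simp add: F_def scale_sum_right scale_scale)
  have ex: "\<exists>t. lift m t" for m
  proof -
    obtain t where t: "F t = m" "\<And>v. F v = 0 \<Longrightarrow> row_inner I t v = 0"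
      using orthogonal_preimage[OF s I g_add g_scale g_section[folded I_def], of m]
      unfolding F_def by blast
    define t' where "t' i = (if i \<in> I then t i else 0)" for i
    have "F t' = F t" "row_inner I t' v = row_inner I t v" for v
      by (simp_all add: F_def row_inner_def t'_def)
    then have "lift m t'" using t by (simp add: lift_def t'_def)
    then show ?thesis by blast
  qed
  \<comment> \<open>The difference of two lifts lies in the kernel of \<open>F\<close> and is
    orthogonal to that kernel, hence to itself.\<close>
  have unique: "t = t'" if "lift m t" "lift m t'" for m t t'
  proof
    fix i
    let ?d = "\<lambda>i. t i - t' i"
    have "F ?d = 0" using that by (simp add: F_diff lift_def)
    then have "row_inner I ?d ?d = 0"
      using that by (simp add: row_inner_diff_left lift_def)
    then show "t i = t' i"
      using row_inner_self_eq_0[OF I, of ?d i] that by (cases "i \<in> I") (auto simp: lift_def)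
  qed
  obtain \<theta> where \<theta>: "\<And>m. lift m (\<theta> m)" using ex by metis
  have F\<theta>: "F (\<theta> m) = m" for m using \<theta> by (simp add: lift_def)
  have orth: "row_inner I (\<theta> m) v = 0" if "F v = 0" for m v using \<theta> that by (simp add: lift_def)
  have \<theta>_add: "\<theta> (m + m') = (\<lambda>i. \<theta> m i + \<theta> m' i)" for m m'
    by (rule unique[OF \<theta>])
       (use \<theta>[of m] \<theta>[of m'] in \<open>simp add: lift_def F_add row_inner_add_left\<close>)
  have \<theta>_diff: "\<theta> (m - m') = (\<lambda>i. \<theta> m i - \<theta> m' i)" for m m'
    by (rule unique[OF \<theta>])
       (use \<theta>[of m] \<theta>[of m'] in \<open>simp add: lift_def F_diff row_inner_diff_left\<close>)
  have \<theta>_scale: "\<theta> (s a m) = (\<lambda>i. a * \<theta> m i)" for a m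
    by (rule unique[OF \<theta>]) (use \<theta>[of m] in \<open>simp add: lift_def F_mult row_inner_mult_left\<close>)
  define ip where "ip z w = row_inner I (\<theta> z) (\<theta> w)" for z w
  have "cstar_inner_product s ip"
    unfolding cstar_inner_product_def
  proof (intro conjI allI)
    show "cstar_positive (ip z z)" for z
      by (simp add: ip_def norm_positive_imp_cstar_positive norm_positive_row_inner)
    show "ip z z = 0 \<longleftrightarrow> z = 0" for z
    proof
      assume "ip z z = 0"
      then have "\<theta> z i = 0" if "i \<in> I" for i
        using row_inner_self_eq_0[OF I, of "\<theta> z" i] that by (simp add: ip_def)
      then have "F (\<theta> z) = 0" by (simp add: F_def)
      then show "z = 0" by (simp add: F\<theta>)
    next
      assume "z = 0"
      then have "\<theta> z = (\<lambda>_. 0)" using \<theta>_diff[of z z] by simp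
      then show "ip z z = 0" by (simp add: ip_def row_inner_def)
    qed
    show "ip z w = star (ip w z)" for z w by (simp add: ip_def star_row_inner)
    show "ip (s a z) w = a * ip z w" for a z w
      by (simp add: ip_def \<theta>_scale row_inner_mult_left)
    show "ip (y + z) w = ip y w + ip z w" for y z w
      by (simp add: ip_def \<theta>_add row_inner_add_left)
  qed
  moreover have "ip_complete ip"
    unfolding ip_complete_def
  proof (intro allI impI)
    fix X :: "nat \<Rightarrow> 'm"
    assume X: "\<forall>e>0. \<exists>N. \<forall>m\<ge>N. \<forall>n\<ge>N. ip_norm ip (X m - X n) < e"
    have bound: "norm (\<theta> (X m) i - \<theta> (X n) i) \<le> ip_norm ip (X m - X n)" if "i \<in> I" for i m n
      using norm_le_row_inner[OF I that, of "\<theta> (X m - X n)"]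
      by (simp add: ip_norm_def ip_def \<theta>_diff real_le_rsqrt)
    have "\<exists>a. (\<lambda>n. \<theta> (X n) i) \<longlonglongrightarrow> a" for i
    proof (cases "i \<in> I")
      case True
      have "Cauchy (\<lambda>n. \<theta> (X n) i)"
      proof (rule CauchyI)
        fix e :: real assume "0 < e"
        then obtain N where "\<And>m n. m \<ge> N \<Longrightarrow> n \<ge> N \<Longrightarrow> ip_norm ip (X m - X n) < e" using X by blast
        then show "\<exists>N. \<forall>m\<ge>N. \<forall>n\<ge>N. norm (\<theta> (X m) i - \<theta> (X n) i) < e"
          using bound[OF True] by (meson le_less_trans)
      qed
      then show ?thesis by (auto simp: Cauchy_convergent_iff convergent_def)
    next
      case False
      then show ?thesis using \<theta> by (auto simp: lift_def intro!: exI[of _ 0])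
    qed
    then obtain a where a: "\<And>i. (\<lambda>n. \<theta> (X n) i) \<longlonglongrightarrow> a i" by metis
    have lim: "(\<lambda>n. row_inner I (\<theta> (X n)) v) \<longlonglongrightarrow> row_inner I a v" for v
      unfolding row_inner_def by (intro tendsto_intros a)
    \<comment> \<open>Orthogonality and vanishing off \<open>I\<close> survive coordinatewise
      limits, so the range of \<open>\<theta>\<close> is closed; this gives completeness.\<close>
    have "lift (F a) a"
      unfolding lift_def
    proof (intro conjI allI impI refl)
      show "row_inner I a v = 0" if "F v = 0" for v
        using lim[of v] by (simp add: orth[OF that] LIMSEQ_const_iff)
      show "a i = 0" if "i \<notin> I" for i
        using a[of i] \<theta> that by (simp add: lift_def LIMSEQ_const_iff)
    qed
    then have \<theta>a: "\<theta> (F a) = a" by (rule unique[OF \<theta>])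
    have "(\<lambda>n. row_inner I (\<theta> (X n - F a)) (\<theta> (X n - F a))) \<longlonglongrightarrow> (\<Sum>i\<in>I. (a i - a i) * star (a i - a i))"
      unfolding row_inner_def \<theta>_diff \<theta>a
      by (intro tendsto_intros a bounded_linear.tendsto[OF bounded_linear_star])
    then have "(\<lambda>n. ip (X n - F a) (X n - F a)) \<longlonglongrightarrow> 0" by (simp add: ip_def)
    then have "(\<lambda>n. ip_norm ip (X n - F a)) \<longlonglongrightarrow> sqrt (norm (0::'a))"
      unfolding ip_norm_def by (intro tendsto_intros)
    then show "\<exists>L. (\<lambda>n. ip_norm ip (X n - L)) \<longlonglongrightarrow> 0" by auto
  qed
  moreover have "normalized_tight_frame ip k x"
    unfolding normalized_tight_frame_def
  proof
    fix z
    \<comment> \<open>The unit row at \<open>j\<close> and \<open>\<theta> (x j)\<close> have the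
      same image under \<open>F\<close>, so their difference is orthogonal to
      \<open>\<theta> z\<close>.\<close>
    have coord: "ip z (x j) = \<theta> z j" if "j \<in> I" for j
    proof -
      let ?e = "\<lambda>i. if i = j then 1 else 0 :: 'a"
      have "F ?e = x j" unfolding F_def by (rule sum_scale_Kronecker[OF I that])
      then have "row_inner I (\<theta> z) (\<lambda>i. ?e i - \<theta> (x j) i) = 0"
        by (intro orth) (simp add: F_diff F\<theta>)
      then have "row_inner I (\<theta> z) (\<theta> (x j)) = row_inner I (\<theta> z) ?e"
        by (simp add: row_inner_diff_right)
      then show ?thesis using row_inner_Kronecker[OF I that] by (simp add: ip_def)
    qed
    have "ip (x j) z = star (\<theta> z j)" if "j \<in> I" for j
      using coord[OF that] by (metis ip_def star_row_inner)
    then show "ip z z = (\<Sum>j = 1..k. ip z (x j) * ip (x j) z)"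
      unfolding I_def[symmetric] by (simp add: coord ip_def[of z z] row_inner_def)
  qed
  ultimately show ?thesis using s unfolding frame_inner_product_def hilbert_module_def by blast
qed

section \<open>Uniqueness, reconstruction and minimal generating sets\<close>

lemma left_module_coord_scale: "left_module (coord_scale :: 'a::{ring,monoid_mult} \<Rightarrow> _)"
  by unfold_locales (simp_all add: coord_scale_def fun_eq_iff distrib_left distrib_right mult.assoc)

lemma sum_fun_apply: "(sum f I :: 'b \<Rightarrow> 'c::comm_monoid_add) j = (\<Sum>i\<in>I. f i j)"
  by (induction I rule: infinite_finite_induct) simp_all

lemma left_submodule_sum:
  assumes "left_submodule s P" "\<And>i. i \<in> I \<Longrightarrow> f i \<in> P"
  shows "sum f I \<in> P"
  using assms(2)
  by (induction I rule: infinite_finite_induct) (use assms(1) in \<open>auto simp: left_submodule_def\<close>)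

lemma left_linear_0: "left_linear s s' f \<Longrightarrow> f 0 = 0"
  unfolding left_linear_def by (metis add.right_neutral add_left_cancel)

lemma left_linear_sum:
  assumes "left_linear s s' f"
  shows "f (\<Sum>i\<in>I. s (a i) (h i)) = (\<Sum>i\<in>I. s' (a i) (f (h i)))"
  by (induction I rule: infinite_finite_induct)
     (simp_all add: left_linear_0[OF assms] assms[unfolded left_linear_def])

text \<open>The \<open>m i\<close> are preimages of the \<open>P\<close>-components of the unit
  rows, and \<open>\<phi>\<close> is the embedding \<open>f\<close>. When \<open>f z\<close> is
  expanded in unit rows, the \<open>Q\<close>-components sum to an element of both \<open>P\<close>
  and \<open>Q\<close>, hence to 0.\<close>

lemma fg_projective_dual_basis:
  fixes s :: "'a::{ring,monoid_mult} \<Rightarrow> 'm::ab_group_add \<Rightarrow> 'm"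
  assumes "fg_projective s"
  obtains n m \<phi> where "left_linear s coord_scale \<phi>"
    "\<And>z. (\<Sum>i<n. s (\<phi> z i) (m i)) = (z::'m)"
proof -
  interpret row: left_module "coord_scale :: 'a \<Rightarrow> _" by (rule left_module_coord_scale)
  obtain n :: nat and P Q :: "(nat \<Rightarrow> 'a) set" and f where
    summand: "left_submodule coord_scale P \<and> P \<subseteq> free_module n \<and>
      left_submodule coord_scale Q \<and> Q \<subseteq> free_module n \<and>
      P \<inter> Q = {0} \<and> (\<forall>v\<in>free_module n. \<exists>p\<in>P. \<exists>q\<in>Q. v = p + q) \<and>
      left_linear s coord_scale f \<and> bij_betw f UNIV P"
    using assms[unfolded fg_projective_def, THEN conjunct2] by (elim exE) (rule that)
  then have P: "left_submodule coord_scale P" "P \<subseteq> free_module n"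
    and Q: "left_submodule coord_scale Q" and PQ: "P \<inter> Q = {0}"
    and split: "\<And>v. v \<in> free_module n \<Longrightarrow> \<exists>p\<in>P. \<exists>q\<in>Q. v = p + q"
    and f: "left_linear s coord_scale f" "bij_betw f UNIV P"
    by simp_all
  define \<delta> :: "nat \<Rightarrow> nat \<Rightarrow> 'a" where "\<delta> i j = (if j = i then 1 else 0)" for i j
  have "\<exists>p q. p \<in> P \<and> q \<in> Q \<and> \<delta> i = p + q" if "i < n" for i
    using split[of "\<delta> i"] that by (auto simp: free_module_def \<delta>_def)
  then obtain p q where pq: "\<And>i. i < n \<Longrightarrow> p i \<in> P \<and> q i \<in> Q \<and> \<delta> i = p i + q i" by metis
  define m where "m i = inv f (p i)" for i
  have fm: "f (m i) = p i" if "i < n" for i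
    using f(2) pq[OF that] unfolding m_def by (metis bij_betw_imp_surj_on f_inv_into_f)
  have "(\<Sum>i<n. s (f z i) (m i)) = z" for z
  proof -
    let ?p = "\<Sum>i<n. coord_scale (f z i) (p i)" and ?q = "\<Sum>i<n. coord_scale (f z i) (q i)"
    have fz: "f z \<in> P" using f(2) by (auto simp: bij_betw_def)
    have "f z = (\<Sum>i<n. coord_scale (f z i) (\<delta> i))"
    proof
      fix j
      have "f z j = 0" if "n \<le> j" using fz P(2) that by (auto simp: free_module_def)
      then show "f z j = (\<Sum>i<n. coord_scale (f z i) (\<delta> i)) j"
        by (cases "j < n")
           (auto simp: sum_fun_apply coord_scale_def \<delta>_def if_distrib[of "\<lambda>a. _ * a"] cong: if_cong)
    qed
    also have "\<dots> = ?p + ?q"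
      by (simp add: pq row.scale_add_right sum.distrib)
    finally have eq: "f z = ?p + ?q" .
    have p: "?p \<in> P" using P(1) pq
      by (intro left_submodule_sum[OF P(1)]) (auto simp: left_submodule_def)
    have q: "?q \<in> Q" using Q pq
      by (intro left_submodule_sum[OF Q]) (auto simp: left_submodule_def)
    have "?q = f z - ?p"
      by (rule add_implies_diff) (subst add.commute, rule eq[symmetric])
    also have "\<dots> = f z + coord_scale (- 1) ?p"
      using row.scale_diff_left[of 0 1 ?p] by (simp add: row.scale_one)
    finally have "?q = f z + coord_scale (- 1) ?p" .
    then have "?q \<in> P" using fz p P(1) unfolding left_submodule_def by metis
    then have "?q = 0" using q PQ by blast
    then have "f z = ?p" using eq by simp
    also have "?p = f (\<Sum>i<n. s (f z i) (m i))"
      by (simp add: left_linear_sum[OF f(1)] fm)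
    finally show ?thesis using f(2) by (metis bij_betw_def injD)
  qed
  then show thesis using f(1) that by blast
qed

text \<open>A dual basis is expanded in the generators with coefficients fixed once. Only the
  dual-basis coordinates depend on \<open>z\<close>, so the combined coefficients are linear in
  \<open>z\<close>.\<close>

lemma fg_projective_section:
  assumes s: "fg_projective s" and x: "algebraic_generators s k x"
  obtains g where "left_linear s coord_scale g" "\<And>z. (\<Sum>j\<in>{1..k}. s (g z j) (x j)) = z"
proof -
  interpret left_module s using s by (simp add: fg_projective_def)
  obtain n m \<phi> where \<phi>: "left_linear s coord_scale \<phi>" "\<And>z. (\<Sum>i<n. s (\<phi> z i) (m i)) = z"
    by (rule fg_projective_dual_basis[OF s]) (rule that; assumption)
  have "\<exists>a. m i = (\<Sum>j\<in>{1..k}. s (a j) (x j))" for i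
    using x by (simp add: algebraic_generators_def)
  then obtain c where c: "\<And>i. m i = (\<Sum>j\<in>{1..k}. s (c i j) (x j))"
    by metis
  define g where "g z j = (\<Sum>i<n. \<phi> z i * c i j)" for z j
  have "left_linear s coord_scale g"
    using \<phi>(1) by (simp add: left_linear_def g_def coord_scale_def fun_eq_iff distrib_right
        sum.distrib sum_distrib_left mult.assoc)
  moreover have "(\<Sum>j\<in>{1..k}. s (g z j) (x j)) = z" for z
  proof -
    have "(\<Sum>j\<in>{1..k}. s (g z j) (x j)) = (\<Sum>i<n. s (\<phi> z i) (m i))"
      unfolding g_def c scale_sum_left scale_sum_right
      by (subst sum.swap) (simp add: scale_scale)
    then show ?thesis by (simp add: \<phi>(2))
  qed
  ultimately show thesis using that by blast
qed

lemma fg_projective_imp_generators: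
  assumes "fg_projective s"
  shows "\<exists>k x. algebraic_generators s k x"
proof -
  obtain n m \<phi> where "left_linear s coord_scale \<phi>" and basis: "\<And>z. (\<Sum>i<n. s (\<phi> z i) (m i)) = z"
    by (rule fg_projective_dual_basis[OF assms]) (rule that; assumption)
  have "z = (\<Sum>i\<in>{1..n}. s (\<phi> z (i - 1)) (m (i - 1)))" for z
    using sum.atLeast1_atMost_eq[of "\<lambda>i. s (\<phi> z (i - 1)) (m (i - 1))" n] basis[of z] by simp
  then have "algebraic_generators s n (\<lambda>i. m (i - 1))"
    unfolding algebraic_generators_def by (intro allI exI)
  then show ?thesis by blast
qed

section \<open>Parseval identity and reconstruction formula\<close>

locale framed_module =
  fixes s :: "'a::unital_cstar_algebra \<Rightarrow> 'm::ab_group_add \<Rightarrow> 'm" and k x ip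
  assumes frame: "frame_inner_product s k x ip"
begin

sublocale left_module s
  using frame by (simp add: frame_inner_product_def hilbert_module_def)

lemma cstar_inner_product: "cstar_inner_product s ip"
  using frame by (simp add: frame_inner_product_def hilbert_module_def)

lemma ip_add_left: "ip (y + z) w = ip y w + ip z w"
  and ip_scale_left: "ip (s a z) w = a * ip z w"
  and ip_definite: "ip z z = 0 \<longleftrightarrow> z = 0"
  using cstar_inner_product unfolding cstar_inner_product_def by blast+

lemma star_ip: "star (ip z w) = ip w z"
  using cstar_inner_product unfolding cstar_inner_product_def by metis

lemma ip_add_right: "ip w (y + z) = ip w y + ip w z"
  by (metis ip_add_left star_add star_ip)

lemma ip_scale_right: "ip w (s a z) = ip w z * star a"
  by (metis ip_scale_left star_mult star_ip)

lemma ip_zero_left [simp]: "ip 0 w = 0"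
  using ip_add_left[of 0 0 w] by simp

lemma ip_diff_left: "ip (y - z) w = ip y w - ip z w"
  using ip_add_left[of "y - z" z w] by simp

lemma ip_sum_left: "ip (\<Sum>i\<in>I. s (a i) (h i)) w = (\<Sum>i\<in>I. a i * ip (h i) w)"
  by (induction I rule: infinite_finite_induct) (simp_all add: ip_add_left ip_scale_left)

text \<open>Polarization: the defect \<open>B\<close> is sesquilinear and zero on the diagonal,
  hence antisymmetric; inserting \<open>i w\<close> for \<open>w\<close> makes it symmetric as
  well.\<close>

lemma parseval: "ip z w = (\<Sum>j\<in>{1..k}. ip z (x j) * ip (x j) w)"
proof -
  define B where "B z w = ip z w - (\<Sum>j\<in>{1..k}. ip z (x j) * ip (x j) w)" for z w
  have diag: "B z z = 0" for z
    using frame by (simp add: B_def frame_inner_product_def normalized_tight_frame_def)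
  have anti: "B z w + B w z = 0" for z w
  proof -
    have "B (z + w) (z + w) = B z z + B w w + (B z w + B w z)"
      by (simp add: B_def ip_add_left ip_add_right distrib_left distrib_right sum.distrib)
    then show ?thesis by (simp only: diag) simp
  qed
  \<comment> \<open>Complex multiples in the module are scalings by multiples of the unit of the
    algebra.\<close>
  let ?w = "s (\<i> *\<^sub>C 1) w"
  have "B z ?w = - (\<i> *\<^sub>C B z w)" "B ?w z = \<i> *\<^sub>C B w z"
    by (simp_all add: B_def ip_scale_left ip_scale_right star_cscale cscale_mult_left
        cscale_mult_right cscale_minus_left cscale_diff_right cscale_sum sum_negf)
  then have "\<i> *\<^sub>C B z w = \<i> *\<^sub>C B w z" using anti[of z ?w] by simp
  then have "\<i> *\<^sub>C \<i> *\<^sub>C B z w = \<i> *\<^sub>C \<i> *\<^sub>C B w z" by simp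
  then have "B z w = B w z" by (simp only: cscale_ii_ii neg_equal_iff_equal)
  then have "2 *\<^sub>R B z w = 0" using anti[of z w] by (simp add: scaleR_2)
  then show ?thesis by (simp add: B_def)
qed

text \<open>By Parseval the difference \<open>d\<close> is orthogonal to every \<open>w\<close>, in
  particular to itself.\<close>

lemma reconstruction: "(\<Sum>j\<in>{1..k}. s (ip z (x j)) (x j)) = z"
proof -
  define d where "d = z - (\<Sum>j\<in>{1..k}. s (ip z (x j)) (x j))"
  have "ip d w = 0" for w
    unfolding d_def ip_diff_left ip_sum_left parseval[of z w, symmetric] by simp
  then have "d = 0" using ip_definite by blast
  then show ?thesis by (simp add: d_def)
qed

end

text \<open>
  The Gram matrices \<open>G\<close>, \<open>G'\<close> of two such inner products are orthogonal projections with the same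
  kernel, so \<open>G G' = G'\<close> and \<open>G' G = G\<close>; taking adjoints gives \<open>G = G'\<close>.
\<close>

lemma frame_inner_product_unique:
  assumes "frame_inner_product s k x ip" "frame_inner_product s k x ip'"
  shows "ip = ip'"
proof -
  interpret f: framed_module s k x ip by unfold_locales (rule assms)
  interpret f': framed_module s k x ip' by unfold_locales (rule assms)
  have G: "ip' z (x j) = (\<Sum>l\<in>{1..k}. ip z (x l) * ip' (x l) (x j))" for z j
    by (subst f.reconstruction[of z, symmetric]) (rule f'.ip_sum_left)
  have G': "ip z (x j) = (\<Sum>l\<in>{1..k}. ip' z (x l) * ip (x l) (x j))" for z j
    by (subst f'.reconstruction[of z, symmetric]) (rule f.ip_sum_left)
  have eq: "ip (x i) (x j) = ip' (x i) (x j)" for i j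
  proof -
    have "ip (x i) (x j) = star (ip (x j) (x i))" by (simp add: f.star_ip)
    also have "\<dots> = star (\<Sum>l\<in>{1..k}. ip' (x j) (x l) * ip (x l) (x i))"
      by (subst G') (rule refl)
    also have "\<dots> = (\<Sum>l\<in>{1..k}. ip (x i) (x l) * ip' (x l) (x j))"
      by (simp add: star_sum star_mult f.star_ip f'.star_ip)
    finally show ?thesis unfolding G[symmetric] .
  qed
  \<comment> \<open>Expanding \<open>z\<close> by the reconstruction formula reduces this to the
    equality of the Gram matrices.\<close>
  have coord: "ip z (x j) = ip' z (x j)" for z j
    by (subst (1 2) f.reconstruction[of z, symmetric])
       (simp add: f.ip_sum_left f'.ip_sum_left eq)
  have "ip z w = ip' z w" for z w
  proof -
    have "ip (x j) w = ip' (x j) w" for j by (metis coord f.star_ip f'.star_ip)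
    then show ?thesis using f.parseval[of z w] f'.parseval[of z w] coord by simp
  qed
  then show ?thesis by blast
qed

lemma fg_projective_ex1_frame_inner_product:
  assumes "fg_projective s" "algebraic_generators s k x"
  shows "\<exists>!ip. frame_inner_product s k x ip"
proof -
  obtain g where g: "left_linear s coord_scale g" "\<And>z. (\<Sum>j\<in>{1..k}. s (g z j) (x j)) = z"
    by (rule fg_projective_section[OF assms]) (rule that; assumption)
  have "\<exists>ip. frame_inner_product s k x ip"
  proof (rule exists_frame_inner_product)
    show "left_module s" using assms(1) by (simp add: fg_projective_def)
    show "g (m + m') i = g m i + g m' i" for m m' i using g(1) by (simp add: left_linear_def)
    show "g (s a m) i = a * g m i" for a m i using g(1) by (simp add: left_linear_def coord_scale_def)
  qed (rule g(2))
  then show ?thesis using frame_inner_product_unique by (auto intro: ex_ex1I)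
qed

text \<open>By Parseval the coordinate row of \<open>z\<close> is fixed by the Gram matrix, which
  both modules share, so \<open>f z\<close> has the same coordinate row as \<open>z\<close>. The map
  \<open>h\<close> does the same in the other direction, and the reconstruction formulas make the
  two mutually inverse.\<close>

lemma equal_gram_imp_isomorphic:
  fixes sM :: "'a::unital_cstar_algebra \<Rightarrow> 'm::ab_group_add \<Rightarrow> 'm"
    and sN :: "'a \<Rightarrow> 'n::ab_group_add \<Rightarrow> 'n"
  assumes "frame_inner_product sM k x ip" "frame_inner_product sN k y ip'"
    and upper: "\<And>i j. i \<in> {1..k} \<Longrightarrow> j \<in> {i..k} \<Longrightarrow> ip' (y i) (y j) = ip (x i) (x j)"
  shows "left_module_isomorphic sM sN"
proof -
  interpret M: framed_module sM k x ip by unfold_locales (rule assms)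
  interpret N: framed_module sN k y ip' by unfold_locales (rule assms)
  \<comment> \<open>Entries below the diagonal follow by taking adjoints.\<close>
  have gram: "ip' (y i) (y j) = ip (x i) (x j)" if "i \<in> {1..k}" "j \<in> {1..k}" for i j
  proof (cases "i \<le> j")
    case False
    then have "ip' (y j) (y i) = ip (x j) (x i)" using that by (intro upper) auto
    then show ?thesis by (metis M.star_ip N.star_ip)
  qed (use that upper in auto)
  define f where "f z = (\<Sum>j\<in>{1..k}. sN (ip z (x j)) (y j))" for z
  define h where "h w = (\<Sum>j\<in>{1..k}. sM (ip' w (y j)) (x j))" for w
  have f_coord: "ip' (f z) (y l) = ip z (x l)" if "l \<in> {1..k}" for z l
    using that M.parseval[of z "x l"] by (simp add: f_def N.ip_sum_left gram del: M.star_ip)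
  have h_coord: "ip (h w) (x l) = ip' w (y l)" if "l \<in> {1..k}" for w l
    using that N.parseval[of w "y l"] by (simp add: h_def M.ip_sum_left gram)
  have "h (f z) = z" for z by (simp add: h_def f_coord M.reconstruction del: One_nat_def)
  moreover have "f (h w) = w" for w by (simp add: f_def h_coord N.reconstruction del: One_nat_def)
  ultimately have "bij f" by (intro bij_betw_byWitness[of _ h]) auto
  moreover have "left_linear sM sN f"
    by (simp add: left_linear_def f_def M.ip_add_left M.ip_scale_left N.scale_add_left sum.distrib
        N.scale_sum_right N.scale_scale)
  ultimately show ?thesis unfolding left_module_isomorphic_def by blast
qed

text \<open>Discarding zeros and repetitions leaves a generating set of at most \<open>k\<close>
  elements, so minimality forces exactly \<open>k\<close>.\<close>

lemma minimal_generators_distinct_nonzero: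
  assumes s: "left_module s" and x: "algebraic_generators s k x"
    and min: "\<And>l y. algebraic_generators s l y \<Longrightarrow> k \<le> l"
  shows "\<exists>y. inj_on y {1..k} \<and> nonzero_generators s k y"
proof -
  interpret left_module s by (rule s)
  define S where "S = x ` {1..k} - {0}"
  have fin: "finite S" by (simp add: S_def)
  obtain y where y: "bij_betw y {1..card S} S" using ex_bij_betw_nat_finite_1[OF fin] by blast
  have gen: "algebraic_generators s (card S) y"
    unfolding algebraic_generators_def
  proof
    fix z
    obtain a where a: "z = (\<Sum>i\<in>{1..k}. s (a i) (x i))"
      using x unfolding algebraic_generators_def by blast
    \<comment> \<open>Collects the coefficients of all indices that carry the same
      generator.\<close>
    define b where "b m = (\<Sum>i | i \<in> {1..k} \<and> x i = m. a i)" for m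
    have "z = (\<Sum>m\<in>x ` {1..k}. \<Sum>i | i \<in> {1..k} \<and> x i = m. s (a i) (x i))"
      unfolding a by (rule sum.image_gen) simp
    also have "\<dots> = (\<Sum>m\<in>x ` {1..k}. s (b m) m)"
      by (intro sum.cong) (simp_all add: b_def scale_sum_left)
    also have "\<dots> = (\<Sum>m\<in>S. s (b m) m)"
      unfolding S_def by (rule sum.mono_neutral_right) auto
    also have "\<dots> = (\<Sum>i\<in>{1..card S}. s (b (y i)) (y i))"
      by (rule sum.reindex_bij_betw[OF y, symmetric])
    finally show "\<exists>a. z = (\<Sum>i\<in>{1..card S}. s (a i) (y i))" by - (rule exI, assumption)
  qed
  have "card S \<le> card (x ` {1..k})" unfolding S_def by (intro card_mono) auto
  also have "\<dots> \<le> k" using card_image_le[of "{1..k}" x] by simp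
  finally have "card S = k" using min[OF gen] by simp
  moreover have "y i \<noteq> 0" if "i \<in> {1..card S}" for i
    using bij_betwE[OF y] that by (auto simp: S_def)
  ultimately show ?thesis
    using gen y unfolding nonzero_generators_def bij_betw_def by metis
qed

theorem corollary3p2:
  fixes sM :: "'a::unital_cstar_algebra \<Rightarrow> 'm::ab_group_add \<Rightarrow> 'm"
    and sN :: "'a \<Rightarrow> 'n::ab_group_add \<Rightarrow> 'n"
  assumes "fg_projective sM"
  shows
    "(\<forall>k x. nonzero_generators sM k x \<longrightarrow> (\<exists>!ip. frame_inner_product sM k x ip)) \<and>
     (fg_projective sN \<longrightarrow>
       (\<forall>k x y ip ip'.
          nonzero_generators sM k x \<and> frame_inner_product sM k x ip \<and>
          nonzero_generators sN k y \<and> frame_inner_product sN k y ip' \<and>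
          (\<forall>i\<in>{1..k}. \<forall>j\<in>{i..k}. ip' (y i) (y j) = ip (x i) (x j)) \<longrightarrow>
          left_module_isomorphic sM sN)) \<and>
     (\<exists>k\<^sub>0.
       (\<exists>x. inj_on x {1..k\<^sub>0} \<and> nonzero_generators sM k\<^sub>0 x) \<and>
       (\<forall>k x. algebraic_generators sM k x \<longrightarrow> k\<^sub>0 \<le> k) \<and>
       (fg_projective sN \<longrightarrow>
         (\<forall>x y ip ip'.
            nonzero_generators sM k\<^sub>0 x \<and> frame_inner_product sM k\<^sub>0 x ip \<and>
            nonzero_generators sN k\<^sub>0 y \<and> frame_inner_product sN k\<^sub>0 y ip' \<and>
            (\<forall>i\<in>{1..k\<^sub>0}. \<forall>j\<in>{i..k\<^sub>0}. ip' (y i) (y j) = ip (x i) (x j)) \<longrightarrow>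
            left_module_isomorphic sM sN)))"
proof -
  have unique: "\<exists>!ip. frame_inner_product sM k x ip" if "nonzero_generators sM k x" for k x
    using fg_projective_ex1_frame_inner_product[OF assms] that
    by (simp add: nonzero_generators_def)
  have iso: "left_module_isomorphic sM sN"
    if "frame_inner_product sM k x ip" "frame_inner_product sN k y ip'"
      "\<forall>i\<in>{1..k}. \<forall>j\<in>{i..k}. ip' (y i) (y j) = ip (x i) (x j)" for k x y ip ip'
    using equal_gram_imp_isomorphic[OF that(1,2)] that(3) by blast
  \<comment> \<open>The minimum runs over all generating families, zero entries and repetitions
    included; a dual basis shows that there is one.\<close>
  define k\<^sub>0 where "k\<^sub>0 = (LEAST k. \<exists>x. algebraic_generators sM k x)"
  have "\<exists>x. algebraic_generators sM k\<^sub>0 x"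
    unfolding k\<^sub>0_def by (rule LeastI_ex) (rule fg_projective_imp_generators[OF assms])
  moreover have min: "k\<^sub>0 \<le> k" if "algebraic_generators sM k x" for k x
    unfolding k\<^sub>0_def by (rule Least_le) (use that in blast)
  moreover have "left_module sM" using assms by (simp add: fg_projective_def)
  ultimately have "\<exists>x. inj_on x {1..k\<^sub>0} \<and> nonzero_generators sM k\<^sub>0 x"
    using minimal_generators_distinct_nonzero by blast
  with min have k\<^sub>0: "(\<exists>x. inj_on x {1..k\<^sub>0} \<and> nonzero_generators sM k\<^sub>0 x) \<and>
      (\<forall>k x. algebraic_generators sM k x \<longrightarrow> k\<^sub>0 \<le> k)" by blast
  show ?thesis
  proof (intro conjI)
    show "\<forall>k x. nonzero_generators sM k x \<longrightarrow> (\<exists>!ip. frame_inner_product sM k x ip)"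
      using unique by simp
  next
    show "fg_projective sN \<longrightarrow>
       (\<forall>k x y ip ip'.
          nonzero_generators sM k x \<and> frame_inner_product sM k x ip \<and>
          nonzero_generators sN k y \<and> frame_inner_product sN k y ip' \<and>
          (\<forall>i\<in>{1..k}. \<forall>j\<in>{i..k}. ip' (y i) (y j) = ip (x i) (x j)) \<longrightarrow>
          left_module_isomorphic sM sN)"
      by (intro impI allI) (elim conjE, rule iso)
  next
    show "\<exists>k\<^sub>0.
       (\<exists>x. inj_on x {1..k\<^sub>0} \<and> nonzero_generators sM k\<^sub>0 x) \<and>
       (\<forall>k x. algebraic_generators sM k x \<longrightarrow> k\<^sub>0 \<le> k) \<and>
       (fg_projective sN \<longrightarrow>
         (\<forall>x y ip ip'.
            nonzero_generators sM k\<^sub>0 x \<and> frame_inner_product sM k\<^sub>0 x ip \<and>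
            nonzero_generators sN k\<^sub>0 y \<and> frame_inner_product sN k\<^sub>0 y ip' \<and>
            (\<forall>i\<in>{1..k\<^sub>0}. \<forall>j\<in>{i..k\<^sub>0}. ip' (y i) (y j) = ip (x i) (x j)) \<longrightarrow>
            left_module_isomorphic sM sN))"
    proof (rule exI[of _ k\<^sub>0], intro conjI)
      show "fg_projective sN \<longrightarrow>
         (\<forall>x y ip ip'.
            nonzero_generators sM k\<^sub>0 x \<and> frame_inner_product sM k\<^sub>0 x ip \<and>
            nonzero_generators sN k\<^sub>0 y \<and> frame_inner_product sN k\<^sub>0 y ip' \<and>
            (\<forall>i\<in>{1..k\<^sub>0}. \<forall>j\<in>{i..k\<^sub>0}. ip' (y i) (y j) = ip (x i) (x j)) \<longrightarrow>
            left_module_isomorphic sM sN)"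
        by (intro impI allI) (elim conjE, rule iso)
    qed (use k\<^sub>0 in blast)+
  qed
qed

end
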